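(* Let $\mathfrak g$ be of orthogonal or symplectic type, let $J_a$ be the universal character of the irreducible $\mathfrak g$-representation of highest weight $a\omega_1$ ($J_0=1$, $J_a=0$ for $a<0$), and consider the family $h^{(r)}_a=J_{a+r}+J_{a-r}$ for $r>0$, $h^{(r)}_a=J_{a+r}$ for $r\le0$, with associated basis $s_\lambda=\chi_{\mathfrak g}(\lambda)$ and associated operators $\psi_k,\psi_k^*,D_p,D^{(p)}$. Then for every $m\in\mathbb Z$ the generating functions $\Psi(u,m)=\sum_{k\in\mathbb Z}\psi_k|_{\mathcal B^{(m)}}u^k$ and $\Psi^*(u,m)=\sum_{k\in\mathbb Z}\psi^*_k|_{\mathcal B^{(m)}}u^{-k}$ are given by $$\Psi(u,m)=u^{m+1}z\,J(u)\,\bigl(DE(-u)+DE(-1/u)-D_0\bigr),$$ $$\Psi^*(u,m)=u^{-m+1}z^{-1}J(u)^{-1}\bigl(DH(u)-DH(1/u)\bigr),$$ where $J(u)=\sum_{s\in\mathbb Z}J_su^s$, $DE(u)=\sum_{p\in\mathbb Z}D_pu^p$ and $DH(u)=\sum_{p\in\mathbb Z}D^{(p)}u^p$.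
   Context: Let $B$ be the ring of symmetric functions over $\mathbb C$ with complete symmetric functions $h_k$ ($h_0=1$, $h_k=0$ for $k<0$). The universal character $J_a$ ($a>0$) of highest weight $a\omega_1$ ($\omega_1$ the first fundamental weight) is $J_a=h_a$ in the symplectic case and $J_a=h_a-h_{a-2}$ in the orthogonal case; $J_0=1$, $J_a=0$ for $a<0$. In either case $B=\mathbb C[J_1,J_2,\dots]$ is a polynomial ring in the $J_a$, $a\ge 1$. With $$h^{(r)}_a=\begin{cases}J_{a+r}+J_{a-r},& r>0,\\ J_{a+r},& r\le0,\end{cases}$$ the universal character $\chi_{\mathfrak g}(\lambda)$ of the irreducible representation with highest weight given by the partition $\lambda=(\lambda_1\ge\dots\ge\lambda_r>0)$ is (known Jacobi–Trudi identity) $\chi_{\mathfrak g}(\lambda)=\det[h^{(j-1)}_{\lambda_i-i+1}]_{1\le i,j\le r}$, and the $\chi_{\mathfrak g}(\lambda)$, over all partitions $\lambda$, form a linear basis of $B$. For any integer vector $\lambda=(\lambda_1,\dots,\lambda_l)$ (parts may be negative and in any order), extended by $\lambda_i=0$ for $i>l$, let $s_\lambda$ be the stable value, for large $N$, of $\det[h^{(j-1)}_{\lambda_i-i+1}]_{1\le i,j\le N}$ (the same for all $N\ge l$); for partitions $s_\lambda=\chi_{\mathfrak g}(\lambda)$. Let $z$ be a variable, $\mathcal B^{(m)}=z^mB$, $\mathcal B=\bigoplus_{m\in\mathbb Z}\mathcal B^{(m)}=B[z,z^{-1}]$. Linear operators $\psi_k,\psi_k^*$ ($k\in\mathbb Z$)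 on $\mathcal B$ are defined on the basis $\{s_\lambda z^m\}$ ($\lambda$ a partition, $m\in\mathbb Z$) by $$\psi_k(s_\lambda z^m)=s_{(k-m-1,\lambda_1,\lambda_2,\dots)}z^{m+1},$$ $$\psi^*_k(s_\lambda z^m)=\sum_{t=1}^\infty(-1)^{t+1}\delta_{k-m-1,\,\lambda_t-t}\;s_{(\lambda_1+1,\dots,\lambda_{t-1}+1,\lambda_{t+1},\lambda_{t+2},\dots)}z^{m-1}.$$ Linear operators $D_p$ and $D^{(p)}$ ($p\in\mathbb Z$) on $B$ are defined on $s_\lambda$, $\lambda=(\lambda_1\ge\dots\ge\lambda_l\ge0)$ a partition, by $$D_p(s_\lambda)=\det\left[h^{(j)}_{\lambda_i-i}\right]_{i=1,\dots,l;\;j=0,1,\dots,\widehat p,\dots,l}\ \text{ if }0\le p\le l,\qquad D_p(s_\lambda)=0\ \text{ otherwise}$$ (the column $j=p$ is omitted), and $$D^{(p)}(s_\lambda)=\sum_{t=1}^\infty(-1)^{t+1}h^{(p)}_{\lambda_t-t+2}\,s_{(\lambda_1+1,\dots,\lambda_{t-1}+1,\lambda_{t+1},\lambda_{t+2},\dots)},$$ where $\lambda_t=0$ for $t>l$ (a finite sum). They are extended to $\mathcal B$ by commuting with $z^{\pm1}$. For each fixed element of $B$ only finitely many $D_p$ and finitely many $D^{(p)}$ are nonzero on it ($D_p=0$ for $p<0$, $D^{(p)}=0$ for $p\ge0$, $D^{(p)}(s_\lambda)=0$ for $-p>\lambda_1+1$). The elements $J_s$ act by multiplication, after the operators $D_p,D^{(p)}$;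 $J(u)^{-1}$ is the inverse formal power series in $u$. The identities are identities of formal series in $u^{\pm1}$ with coefficients operators from $\mathcal B^{(m)}$ to $\mathcal B^{(m\pm1)}$. *)

theory Defs
  imports
    Complex_Main
    "HOL-Library.Poly_Mapping"
    "HOL-Library.Function_Algebras"
    "HOL-Library.FuncSet"
    "HOL-Computational_Algebra.Formal_Power_Series"
    "Jordan_Normal_Form.Determinant"
begin

section \<open>The ring of symmetric functions and the boson space\<close>

text \<open>
  The ring \<open>B\<close> of symmetric functions over the complex numbers is the polynomial ring
  \<open>\<complex>[h\<^sub>1, h\<^sub>2, \<dots>]\<close>. A monomial is its exponent vector; the variable with index \<open>i\<close>
  is \<open>h\<close> of degree \<open>i + 1\<close>, so that there is no spare variable.
\<close>

type_synonym symf = "(nat \<Rightarrow>\<^sub>0 nat) \<Rightarrow>\<^sub>0 complex"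

definition hsym :: "int \<Rightarrow> symf" where
  "hsym k =
     (if k < 0 then 0
      else if k = 0 then 1
      else Poly_Mapping.single (Poly_Mapping.single (nat k - 1) 1) 1)"

text \<open>The Laurent polynomials \<open>B[z, z\<^sup>-\<^sup>1]\<close>.\<close>

type_synonym fock = "int \<Rightarrow>\<^sub>0 symf"

definition inB :: "symf \<Rightarrow> fock" where
  "inB f = Poly_Mapping.single 0 f"

definition zpow :: "int \<Rightarrow> fock" where
  "zpow m = Poly_Mapping.single m 1"

definition charge :: "int \<Rightarrow> fock set" where
  "charge m = range (\<lambda>f. zpow m * inB f)"

definition scaleB :: "complex \<Rightarrow> symf \<Rightarrow> symf" where
  "scaleB c f = Poly_Mapping.single 0 c * f"

definition scaleF :: "complex \<Rightarrow> fock \<Rightarrow> fock" where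
  "scaleF c F = inB (Poly_Mapping.single 0 c) * F"


section \<open>Universal characters\<close>

datatype lie_type = Orthogonal | Symplectic

text \<open>As \<open>h\<^sub>0 = 1\<close> and \<open>h\<^sub>k = 0\<close> for \<open>k < 0\<close>, this yields \<open>J\<^sub>0 = 1\<close> and
  \<open>J\<^sub>a = 0\<close> for \<open>a < 0\<close> in both cases.\<close>

definition J :: "lie_type \<Rightarrow> int \<Rightarrow> symf" where
  "J g a = (case g of Symplectic \<Rightarrow> hsym a | Orthogonal \<Rightarrow> hsym a - hsym (a - 2))"

text \<open>\<open>hr g r a\<close> is $h^{(r)}_a$.\<close>

definition hr :: "lie_type \<Rightarrow> int \<Rightarrow> int \<Rightarrow> symf" where
  "hr g r a = (if r > 0 then J g (a + r) + J g (a - r) else J g (a + r))"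

text \<open>
  An integer vector, extended by zeros, is a function whose entries are indexed from 1
  (the value at index 0 is never used) and which is eventually zero. Matrices are indexed
  from 0, whence the shifts in \<open>jacobi_trudi\<close> and \<open>Dlow\<close>.
\<close>

definition jacobi_trudi :: "lie_type \<Rightarrow> (nat \<Rightarrow> int) \<Rightarrow> nat \<Rightarrow> symf" where
  "jacobi_trudi g lam N =
     det (mat N N (\<lambda>(i0, j0).
       let i = i0 + 1; j = j0 + 1 in hr g (int j - 1) (lam i - int i + 1)))"

text \<open>The stable value of the Jacobi--Trudi determinants.\<close>

definition schar :: "lie_type \<Rightarrow> (nat \<Rightarrow> int) \<Rightarrow> symf" where
  "schar g lam = (THE x. \<forall>\<^sub>F N in sequentially. jacobi_trudi g lam N = x)"

definition is_partition :: "(nat \<Rightarrow> int) \<Rightarrow> bool" where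
  "is_partition lam \<longleftrightarrow>
     (\<forall>i\<ge>1. 0 \<le> lam (i + 1) \<and> lam (i + 1) \<le> lam i) \<and> (\<exists>l. \<forall>i>l. lam i = 0)"

text \<open>\<open>(a, \<lambda>\<^sub>1, \<lambda>\<^sub>2, \<dots>)\<close>\<close>

definition prepend :: "int \<Rightarrow> (nat \<Rightarrow> int) \<Rightarrow> nat \<Rightarrow> int" where
  "prepend a lam i = (if i = 1 then a else lam (i - 1))"

text \<open>\<open>(\<lambda>\<^sub>1 + 1, \<dots>, \<lambda>\<^sub>t\<^sub>-\<^sub>1 + 1, \<lambda>\<^sub>t\<^sub>+\<^sub>1, \<lambda>\<^sub>t\<^sub>+\<^sub>2, \<dots>)\<close>\<close>

definition remove_part :: "nat \<Rightarrow> (nat \<Rightarrow> int) \<Rightarrow> nat \<Rightarrow> int" where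
  "remove_part t lam i = (if i < t then lam i + 1 else lam (i + 1))"


section \<open>Operators\<close>

text \<open>
  Each operator is the unique linear map with the prescribed values on a basis: the
  characters of partitions form a basis of \<open>B\<close>, their products with powers of \<open>z\<close> a basis
  of \<open>B[z, z\<^sup>-\<^sup>1]\<close>. The sums over \<open>t\<close> have finitely many nonzero terms.
\<close>

definition psi :: "lie_type \<Rightarrow> int \<Rightarrow> fock \<Rightarrow> fock" where
  "psi g k = (THE T. Vector_Spaces.linear scaleF scaleF T \<and>
     (\<forall>lam m. is_partition lam \<longrightarrow>
        T (inB (schar g lam) * zpow m) =
          inB (schar g (prepend (k - m - 1) lam)) * zpow (m + 1)))"

definition psi_star :: "lie_type \<Rightarrow> int \<Rightarrow> fock \<Rightarrow> fock" where
  "psi_star g k = (THE T. Vector_Spaces.linear scaleF scaleF T \<and>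
     (\<forall>lam m. is_partition lam \<longrightarrow>
        T (inB (schar g lam) * zpow m) =
          inB (Sum_any (\<lambda>t. (- 1) ^ (t + 1) * schar g (remove_part t lam)
                 when t \<ge> 1 \<and> k - m - 1 = lam t - int t)) * zpow (m - 1)))"

text \<open>
  \<open>Dlow g p\<close> is $D_p$. The number \<open>l\<close> may exceed the number of positive parts of the
  partition; appending zeros does not change the prescribed value.
\<close>

definition Dlow :: "lie_type \<Rightarrow> int \<Rightarrow> symf \<Rightarrow> symf" where
  "Dlow g p = (THE T. Vector_Spaces.linear scaleB scaleB T \<and>
     (\<forall>lam l. is_partition lam \<and> (\<forall>i>l. lam i = 0) \<longrightarrow>
        T (schar g lam) =
          (if 0 \<le> p \<and> p \<le> int l then
             det (mat l l (\<lambda>(i0, j0).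
               let i = i0 + 1; j = (if int j0 < p then j0 else j0 + 1)
               in hr g (int j) (lam i - int i)))
           else 0)))"

text \<open>\<open>Dup g p\<close> is $D^{(p)}$.\<close>

definition Dup :: "lie_type \<Rightarrow> int \<Rightarrow> symf \<Rightarrow> symf" where
  "Dup g p = (THE T. Vector_Spaces.linear scaleB scaleB T \<and>
     (\<forall>lam. is_partition lam \<longrightarrow>
        T (schar g lam) =
          Sum_any (\<lambda>t. (- 1) ^ (t + 1) * hr g p (lam t - int t + 2) * schar g (remove_part t lam)
            when t \<ge> 1)))"

text \<open>The extension of a linear operator on \<open>B\<close> that commutes with \<open>z\<close> acts coefficientwise.\<close>

definition extend_z :: "(symf \<Rightarrow> symf) \<Rightarrow> fock \<Rightarrow> fock" where
  "extend_z T = Poly_Mapping.map T"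


section \<open>Formal series in \<open>u\<close> and its inverse with operator coefficients\<close>

text \<open>\<open>A n\<close> is the coefficient of \<open>u\<^sup>n\<close>; sums and differences are pointwise.\<close>

type_synonym op_series = "int \<Rightarrow> fock \<Rightarrow> fock"

text \<open>The product; in every product below, on each element only finitely many terms are nonzero.\<close>

definition ser_mult :: "op_series \<Rightarrow> op_series \<Rightarrow> op_series" (infixr \<open>\<star>\<close> 70) where
  "(A \<star> B) n F = Sum_any (\<lambda>i. A i (B (n - i) F))"

definition ser_monom :: "int \<Rightarrow> (fock \<Rightarrow> fock) \<Rightarrow> op_series" where
  "ser_monom k T n F = (T F when n = k)"

text \<open>Substitution of \<open>-u\<close> and of \<open>1/u\<close> for \<open>u\<close>.\<close>

definition subst_neg :: "op_series \<Rightarrow> op_series" where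
  "subst_neg A n F = (- 1) ^ nat \<bar>n\<bar> * A n F"

definition subst_inv :: "op_series \<Rightarrow> op_series" where
  "subst_inv A n = A (- n)"

definition ser_restrict :: "int \<Rightarrow> op_series \<Rightarrow> op_series" where
  "ser_restrict m A = (\<lambda>n. restrict (A n) (charge m))"

definition Jser :: "lie_type \<Rightarrow> op_series" where
  "Jser g n F = inB (J g n) * F"

text \<open>The inverse power series exists because the constant coefficient \<open>J\<^sub>0\<close> is 1, which is
  the second argument of \<open>fps_right_inverse\<close>.\<close>

definition Jser_inv :: "lie_type \<Rightarrow> op_series" where
  "Jser_inv g n F =
     (inB (fps_nth (fps_right_inverse (Abs_fps (\<lambda>s. J g (int s))) 1) (nat n)) * F when n \<ge> 0)"

definition DE :: "lie_type \<Rightarrow> op_series" where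
  "DE g p = extend_z (Dlow g p)"

definition DH :: "lie_type \<Rightarrow> op_series" where
  "DH g p = extend_z (Dup g p)"

definition Psi :: "lie_type \<Rightarrow> int \<Rightarrow> op_series" where
  "Psi g m = ser_restrict m (\<lambda>k. psi g k)"

definition Psi_star :: "lie_type \<Rightarrow> int \<Rightarrow> op_series" where
  "Psi_star g m = ser_restrict m (\<lambda>n. psi_star g (- n))"

end

theory Submission
  imports Defs
begin

text \<open>
  The product of the entries \<open>h\<^sup>(\<^sup>j\<^sup>)\<^sub>a\<close> along the permutation \<open>\<sigma>\<close> in the Jacobi--Trudi determinant
  is a monomial of weight \<open>|\<lambda>|\<close> in the \<open>h\<^sub>k\<close>, or zero, up to terms of lower weight. The sum of the
  squares of the indices in this monomial is minimal for \<open>\<sigma> = id\<close> only, so the characters are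
  unitriangular in the monomials of \<open>B\<close>. Hence they form a basis and the operators exist.

  The first identity is then the expansion of \<open>s\<close> at \<open>(k - m - 1, \<lambda>)\<close> along the first row. For the
  second one, \<open>D\<^sup>(\<^sup>p\<^sup>)(s\<^sub>\<lambda>)\<close> is a determinant expanded along its first column, which
  vanishes for \<open>p \<ge> 0\<close> as two columns coincide. Together with
  \<open>h\<^sup>(\<^sup>p\<^sup>)\<^sub>a = J\<^sub>a\<^sub>+\<^sub>p + J\<^sub>a\<^sub>-\<^sub>p\<close> for \<open>p > 0\<close>, this
  turns \<open>DH(u) - DH(1/u)\<close> into the sum over \<open>t\<close> of \<open>J(u)\<close> times a power of \<open>u\<close> times a character,
  up to sign, and multiplication by \<open>J(u)\<^sup>-\<^sup>1\<close> leaves the defining sum of \<open>\<psi>\<^sup>*\<close>.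
\<close>

section \<open>Stable Jacobi--Trudi determinants\<close>

text \<open>Applied to the row of a zero part, which is \<open>(0, ..., 0, 1)\<close>: the expansion
  just drops the last row and column, the sign being even.\<close>

lemma det_last_row_unit:
  fixes A :: "'a :: comm_ring_1 mat"
  assumes A: "A \<in> carrier_mat (Suc n) (Suc n)"
    and zero: "\<And>j. j < n \<Longrightarrow> A $$ (n, j) = 0" and one: "A $$ (n, n) = 1"
  shows "det A = det (mat n n (\<lambda>(i, j). A $$ (i, j)))"
proof -
  have "det A = (\<Sum>j<Suc n. A $$ (n, j) * cofactor A n j)"
    by (rule laplace_expansion_row[OF A]) simp
  also have "\<dots> = cofactor A n n"
    by (simp add: zero one)
  also have "\<dots> = det (mat_delete A n n)"
    by (simp add: cofactor_def flip: mult_2)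
  also have "mat_delete A n n = mat n n (\<lambda>(i, j). A $$ (i, j))"
    using A by (auto simp: mat_delete_def)
  finally show ?thesis .
qed

lemma hsym_0 [simp]: "hsym 0 = 1" and hsym_neg [simp]: "k < 0 \<Longrightarrow> hsym k = 0"
  by (simp_all add: hsym_def)

lemma J_0 [simp]: "J g 0 = 1" and J_neg [simp]: "a < 0 \<Longrightarrow> J g a = 0"
  by (simp_all add: J_def split: lie_type.split)

definition zero_beyond :: "nat \<Rightarrow> (nat \<Rightarrow> int) \<Rightarrow> bool" where
  "zero_beyond l lam \<longleftrightarrow> (\<forall>i>l. lam i = 0)"

lemma zero_beyond_mono: "zero_beyond l lam \<Longrightarrow> l \<le> l' \<Longrightarrow> zero_beyond l' lam"
  by (auto simp: zero_beyond_def)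

lemma is_partition_zero_beyond: "is_partition lam \<Longrightarrow> \<exists>l. zero_beyond l lam"
  by (simp add: is_partition_def zero_beyond_def)

text \<open>The new row has the entries \<open>hr g j (- N)\<close> with \<open>j \<le> N\<close>.
  All their \<open>J\<close> indices are negative, except for \<open>J g 0 = 1\<close> at
  \<open>j = N\<close>.\<close>

lemma jacobi_trudi_Suc:
  assumes "zero_beyond N lam"
  shows "jacobi_trudi g lam (Suc N) = jacobi_trudi g lam N"
proof -
  have "lam (Suc N) = 0"
    using assms by (simp add: zero_beyond_def)
  then show ?thesis
    unfolding jacobi_trudi_def
    by (subst det_last_row_unit) (auto simp: hr_def Let_def intro!: arg_cong[of _ _ det])
qed

lemma schar_eq_jacobi_trudi:
  assumes "zero_beyond l lam" "l \<le> N"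
  shows "schar g lam = jacobi_trudi g lam N"
proof -
  have stable: "jacobi_trudi g lam M = jacobi_trudi g lam l" if "l \<le> M" for M
    using that
    by (induction M rule: dec_induct)
       (auto simp: jacobi_trudi_Suc zero_beyond_mono[OF assms(1)])
  have ev: "\<forall>\<^sub>F M in sequentially. jacobi_trudi g lam M = jacobi_trudi g lam N"
    using stable assms(2) by (intro eventually_sequentiallyI[of l]) metis
  show ?thesis
    unfolding schar_def
  proof (rule the_equality)
    fix x assume "\<forall>\<^sub>F M in sequentially. jacobi_trudi g lam M = x"
    with ev have "\<forall>\<^sub>F M in sequentially. x = jacobi_trudi g lam N"
      by eventually_elim simp
    then show "x = jacobi_trudi g lam N"
      by simp
  qed (fact ev)
qed

text \<open>Functions that differ only at index 0 stand for the same partition, so values prescribed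
  on characters must ignore that entry.\<close>

lemma schar_cong:
  assumes "\<And>i. i \<ge> 1 \<Longrightarrow> lam i = mu i"
  shows "schar g lam = schar g mu"
proof -
  have "jacobi_trudi g lam = jacobi_trudi g mu"
    using assms by (intro ext) (simp add: jacobi_trudi_def Let_def)
  then show ?thesis
    by (simp add: schar_def)
qed

lemma zero_beyond_prepend: "zero_beyond l lam \<Longrightarrow> zero_beyond (Suc l) (prepend a lam)"
  by (auto simp: zero_beyond_def prepend_def)

lemma zero_beyond_remove_part:
  assumes "zero_beyond l lam" "l \<le> N" "t \<le> Suc N"
  shows "zero_beyond N (remove_part t lam)"
  using assms by (auto simp: zero_beyond_def remove_part_def)

text \<open>The minor of the Jacobi--Trudi matrix of \<open>prepend a lam\<close> left after
  deleting the first row and the column of \<open>h^(p)\<close>.\<close>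

definition dlow_mat :: "lie_type \<Rightarrow> (nat \<Rightarrow> int) \<Rightarrow> nat \<Rightarrow> nat \<Rightarrow> symf mat" where
  "dlow_mat g lam p l = mat l l (\<lambda>(i, j). hr g (int (if j < p then j else Suc j)) (lam (Suc i) - int (Suc i)))"

text \<open>As \<open>p \<le> l\<close>, the last column carries superscript \<open>l + 1\<close>,
  and its entry in the new row is \<open>J g 0 = 1\<close>; the other entries of that row
  vanish.\<close>

lemma det_dlow_mat_Suc:
  assumes "zero_beyond l lam" "p \<le> l"
  shows "det (dlow_mat g lam p (Suc l)) = det (dlow_mat g lam p l)"
proof -
  have "lam (Suc l) = 0"
    using assms by (simp add: zero_beyond_def)
  then show ?thesis
    using assms(2) unfolding dlow_mat_def
    by (subst det_last_row_unit) (auto simp: hr_def intro!: arg_cong[of _ _ det])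
qed

text \<open>The omitted column is the only one with a nonzero entry in the new row.\<close>

lemma det_dlow_mat_zero:
  assumes "zero_beyond l lam"
  shows "det (dlow_mat g lam (Suc l) (Suc l)) = 0"
proof -
  have "lam (Suc l) = 0"
    using assms by (simp add: zero_beyond_def)
  then have "dlow_mat g lam (Suc l) (Suc l) $$ (l, j) = 0" if "j < Suc l" for j
    using that by (auto simp: dlow_mat_def hr_def)
  then show ?thesis
    by (subst laplace_expansion_row[of _ "Suc l" l]) (auto simp: dlow_mat_def)
qed

definition dlow :: "lie_type \<Rightarrow> int \<Rightarrow> (nat \<Rightarrow> int) \<Rightarrow> nat \<Rightarrow> symf" where
  "dlow g p lam l = (if 0 \<le> p \<and> p \<le> int l then det (dlow_mat g lam (nat p) l) else 0)"

text \<open>A further zero part admits just one new index, \<open>p = l + 1\<close>, and that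
  determinant vanishes.\<close>

lemma dlow_Suc: "zero_beyond l lam \<Longrightarrow> dlow g p lam (Suc l) = dlow g p lam l"
  using det_dlow_mat_zero[of l lam g]
  by (cases "p = int (Suc l)") (auto simp: dlow_def det_dlow_mat_Suc nat_le_iff simp del: of_nat_Suc)

lemma dlow_stable:
  assumes "zero_beyond l lam" "zero_beyond l' lam"
  shows "dlow g p lam l = dlow g p lam l'"
proof -
  have *: "dlow g p lam M = dlow g p lam k" if "zero_beyond k lam" "k \<le> M" for k M
    using that(2)
    by (induction M rule: dec_induct) (auto simp: dlow_Suc zero_beyond_mono[OF that(1)])
  show ?thesis
    using *[OF assms(1), of "max l l'"] *[OF assms(2), of "max l l'"] by simp
qed

lemma dlow_cong:
  assumes "\<And>i. i \<ge> 1 \<Longrightarrow> lam i = mu i"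
  shows "dlow g p lam l = dlow g p mu l"
  using assms by (simp add: dlow_def dlow_mat_def)

text \<open>Laplace expansion along the first row. The cofactors do not involve \<open>a\<close>,
  which enters through \<open>hr g (int p) a\<close> alone.\<close>

lemma schar_prepend:
  assumes "zero_beyond l lam"
  shows "schar g (prepend a lam) =
    (\<Sum>p\<le>l. (- 1) ^ p * hr g (int p) a * dlow g (int p) lam l)"
proof -
  let ?A = "mat (Suc l) (Suc l) (\<lambda>(i0, j0).
       let i = i0 + 1; j = j0 + 1 in hr g (int j - 1) (prepend a lam i - int i + 1))"
  have "schar g (prepend a lam) = det ?A"
    using schar_eq_jacobi_trudi[OF zero_beyond_prepend[OF assms] order_refl]
    by (simp add: jacobi_trudi_def)
  also have "\<dots> = (\<Sum>p<Suc l. ?A $$ (0, p) * cofactor ?A 0 p)"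
    by (rule laplace_expansion_row) auto
  also have "\<dots> = (\<Sum>p<Suc l. (- 1) ^ p * hr g (int p) a * dlow g (int p) lam l)"
  proof (rule sum.cong[OF refl])
    fix p assume "p \<in> {..<Suc l}"
    moreover have "mat_delete ?A 0 p = dlow_mat g lam p l"
      by (rule eq_matI) (auto simp: mat_delete_def dlow_mat_def prepend_def Let_def algebra_simps)
    ultimately show "?A $$ (0, p) * cofactor ?A 0 p =
        (- 1) ^ p * hr g (int p) a * dlow g (int p) lam l"
      by (simp add: cofactor_def dlow_def prepend_def)
  qed
  finally show ?thesis
    by (simp add: lessThan_Suc_atMost)
qed

text \<open>The sum is the expansion, along its first column, of a determinant in which the column
  \<open>h\<^sup>(\<^sup>n\<^sup>)\<close> occurs twice.\<close>

lemma sum_remove_part_zero: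
  assumes "zero_beyond l lam" "l < N" "n < N - 1"
  shows "(\<Sum>t = 1..N. (- 1) ^ (t + 1) * hr g (int n) (lam t - int t + 2) * schar g (remove_part t lam)) = 0"
proof -
  \<comment> \<open>Columns 1 to \<open>N - 1\<close> carry \<open>h^(0)\<close> to
    \<open>h^(N-2)\<close>, so \<open>n < N - 1\<close> ensures that column \<open>Suc n\<close>
    exists and agrees with column 0.\<close>
  let ?A = "mat N N (\<lambda>(i, j). hr g (int (if j = 0 then n else j - 1)) (lam (Suc i) - int (Suc i) + 2))"
  have "0 = det ?A"
    using assms by (intro sym[OF det_identical_columns[of _ N 0 "Suc n"]]) auto
  also have "\<dots> = (\<Sum>i<N. ?A $$ (i, 0) * cofactor ?A i 0)"
    using assms by (intro laplace_expansion_column) auto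
  also have "\<dots> = (\<Sum>i<N. (- 1) ^ i * hr g (int n) (lam (Suc i) - int (Suc i) + 2) *
      schar g (remove_part (Suc i) lam))"
  proof (rule sum.cong[OF refl])
    fix i assume i: "i \<in> {..<N}"
    \<comment> \<open>The offset \<open>+ 2\<close> in place of \<open>+ 1\<close> raises the parts
      above row \<open>i\<close> by 1; below it, the shift of the rows absorbs the
      difference.\<close>
    have "mat_delete ?A i 0 = mat (N - 1) (N - 1) (\<lambda>(i0, j0).
       let i' = i0 + 1; j = j0 + 1 in hr g (int j - 1) (remove_part (Suc i) lam i' - int i' + 1))"
      using i by (intro eq_matI) (auto simp: mat_delete_def remove_part_def Let_def algebra_simps)
    moreover have "zero_beyond (N - 1) (remove_part (Suc i) lam)"
      using i assms by (intro zero_beyond_remove_part[of l]) auto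
    ultimately have "det (mat_delete ?A i 0) = schar g (remove_part (Suc i) lam)"
      using schar_eq_jacobi_trudi[of "N - 1" "remove_part (Suc i) lam" "N - 1" g]
      by (simp add: jacobi_trudi_def)
    then show "?A $$ (i, 0) * cofactor ?A i 0 =
      (- 1) ^ i * hr g (int n) (lam (Suc i) - int (Suc i) + 2) * schar g (remove_part (Suc i) lam)"
      using i by (simp add: cofactor_def)
  qed
  also have "\<dots> = (\<Sum>t = 1..N. (- 1) ^ (t + 1) * hr g (int n) (lam t - int t + 2) * schar g (remove_part t lam))"
    by (simp add: lessThan_atLeast0 sum.atLeast_Suc_atMost_Suc_shift sum.atLeast1_atMost_eq
         atLeastLessThanSuc_atLeastAtMost)
  finally show ?thesis
    by simp
qed

section \<open>Exponent vectors and partitions\<close>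

type_synonym expo = "nat \<Rightarrow>\<^sub>0 nat"

text \<open>One additive statistic with three uses: degree, sum of squared indices, and number of
  factors beyond a given index.\<close>

definition wt :: "(nat \<Rightarrow> nat) \<Rightarrow> expo \<Rightarrow> nat" where
  "wt c e = Sum_any (\<lambda>i. c i * Poly_Mapping.lookup e i)"

lemma finite_wt_support [simp]: "finite {i. 0 < c i \<and> 0 < Poly_Mapping.lookup (e :: expo) i}"
  by (rule finite_subset[of _ "Poly_Mapping.keys e"]) (auto simp: in_keys_iff)

lemma wt_add: "wt c (d + e) = wt c d + wt c e"
  unfolding wt_def by (subst Sum_any.distrib[symmetric]) (auto simp: lookup_add algebra_simps)

lemma wt_0 [simp]: "wt c 0 = 0"
  by (simp add: wt_def)

lemma wt_sum: "wt c (\<Sum>i\<in>A. e i) = (\<Sum>i\<in>A. wt c (e i))"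
  by (induction A rule: infinite_finite_induct) (auto simp: wt_add)

lemma wt_single [simp]: "wt c (Poly_Mapping.single k n) = c k * n"
  by (simp add: wt_def lookup_single mult_when)

lemma wt_keys: "wt c e = (\<Sum>i\<in>Poly_Mapping.keys e. c i * Poly_Mapping.lookup e i)"
  unfolding wt_def by (rule Sum_any.expand_superset) (auto simp: in_keys_iff)

text \<open>Variable \<open>i\<close> is \<open>hsym (int i + 1)\<close>, whence the successors. On
  the exponent of a partition, \<open>tailcount k\<close> counts the parts larger than
  \<open>k\<close>; these counts form the conjugate partition.\<close>

abbreviation "weight \<equiv> wt Suc"
abbreviation "sqweight \<equiv> wt (\<lambda>i. (Suc i)\<^sup>2)"
abbreviation "tailcount k \<equiv> wt (\<lambda>i. if k \<le> i then 1 else 0)"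

text \<open>Every index that occurs is at most the weight. The bound is what makes descents of fixed
  weight in \<open>exp_less\<close> finite.\<close>

lemma sqweight_le: "sqweight e \<le> (weight e)\<^sup>2"
proof -
  have "Suc i * Poly_Mapping.lookup e i * Suc i \<le> Suc i * Poly_Mapping.lookup e i * weight e"
    if "i \<in> Poly_Mapping.keys e" for i
  proof -
    have "Suc i * 1 \<le> Suc i * Poly_Mapping.lookup e i"
      using that by (intro mult_le_mono2) (auto simp: in_keys_iff)
    also have "\<dots> \<le> weight e"
      unfolding wt_keys using that by (intro member_le_sum) auto
    finally show ?thesis
      by (intro mult_le_mono2) simp
  qed
  then have "sqweight e \<le> (\<Sum>i\<in>Poly_Mapping.keys e. Suc i * Poly_Mapping.lookup e i * weight e)"
    unfolding wt_keys[of "\<lambda>i. (Suc i)\<^sup>2"] by (intro sum_mono) (simp add: power2_eq_square algebra_simps)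
  also have "\<dots> = (weight e)\<^sup>2"
    by (simp add: wt_keys[of Suc] power2_eq_square flip: sum_distrib_right)
  finally show ?thesis .
qed

lemma tailcount_Suc: "tailcount k e = Poly_Mapping.lookup e k + tailcount (Suc k) e"
proof -
  have "tailcount k e = Sum_any (\<lambda>i. (Poly_Mapping.lookup e i when i = k) +
      (if Suc k \<le> i then 1 else 0) * Poly_Mapping.lookup e i)"
    unfolding wt_def by (rule Sum_any.cong) (auto simp: when_def Suc_le_eq)
  also have "\<dots> = Poly_Mapping.lookup e k + tailcount (Suc k) e"
    unfolding wt_def by (subst Sum_any.distrib) (auto intro: finite_subset[of _ "{k}"] simp: when_def)
  finally show ?thesis .
qed

lemma tailcount_inject:
  assumes "\<And>k. tailcount k d = tailcount k e"
  shows "d = e"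
proof (rule poly_mapping_eqI)
  fix k
  show "Poly_Mapping.lookup d k = Poly_Mapping.lookup e k"
    using tailcount_Suc[of k d] tailcount_Suc[of k e] assms by simp
qed

lemma tailcount_antimono: "k \<le> k' \<Longrightarrow> tailcount k' e \<le> tailcount k e"
proof (induction k' rule: dec_induct)
  case (step n)
  with tailcount_Suc[of n e] show ?case
    by linarith
qed simp

lemma tailcount_eventually_0: "\<exists>K. tailcount K e = 0"
proof -
  obtain K where "\<And>i. i \<in> Poly_Mapping.keys e \<Longrightarrow> i < K"
    using finite_nat_set_iff_bounded[of "Poly_Mapping.keys e"] by auto
  then have "tailcount K e = 0"
    unfolding wt_keys by (intro sum.neutral ballI) (auto simp flip: not_less)
  then show ?thesis ..
qed

text \<open>The exponent of \<open>hsym a\<close>, empty for \<open>hsym 0 = 1\<close>. For negative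
  \<open>a\<close> the value 0 is a mere default, as \<open>hsym a\<close> is then no monomial but
  0.\<close>

definition hexp :: "int \<Rightarrow> expo" where
  "hexp a = (if a > 0 then Poly_Mapping.single (nat a - 1) 1 else 0)"

lemma hsym_eq_single: "a \<ge> 0 \<Longrightarrow> hsym a = Poly_Mapping.single (hexp a) 1"
  by (auto simp: hsym_def hexp_def)

lemma weight_hexp: "a \<ge> 0 \<Longrightarrow> int (weight (hexp a)) = a"
  by (auto simp: hexp_def)

lemma sqweight_hexp: "a \<ge> 0 \<Longrightarrow> int (sqweight (hexp a)) = a\<^sup>2"
  by (auto simp: hexp_def Suc_diff_Suc)

lemma tailcount_hexp: "tailcount k (hexp a) = (if int k < a then 1 else 0)"
  by (auto simp: hexp_def)

text \<open>The exponent vector of the complete symmetric function \<open>h_lambda\<close>.\<close>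

definition mon :: "nat \<Rightarrow> (nat \<Rightarrow> int) \<Rightarrow> expo" where
  "mon N lam = (\<Sum>i<N. hexp (lam (Suc i)))"

lemma partition_antimono:
  assumes "is_partition lam" "1 \<le> i" "i \<le> j"
  shows "lam j \<le> lam i"
  using assms(3,2)
  by (induction j rule: dec_induct) (use assms(1) in \<open>auto simp: is_partition_def intro: order_trans\<close>)

lemma partition_nonneg: "is_partition lam \<Longrightarrow> 1 \<le> i \<Longrightarrow> 0 \<le> lam i"
  unfolding is_partition_def by (metis Suc_eq_plus1 order_trans)

text \<open>Since \<open>\<lambda>\<close> is decreasing, the indices of its parts larger than \<open>k\<close> form an initial segment.\<close>

lemma tailcount_mon_iff:
  assumes lam: "is_partition lam" and N: "zero_beyond N lam" and i: "1 \<le> i"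
  shows "i \<le> tailcount k (mon N lam) \<longleftrightarrow> int k < lam i"
proof -
  define S where "S = {j. j < N \<and> int k < lam (Suc j)}"
  have card: "tailcount k (mon N lam) = card S"
  proof -
    have "tailcount k (mon N lam) = (\<Sum>j<N. if int k < lam (Suc j) then 1 else 0)"
      by (simp add: mon_def wt_sum tailcount_hexp)
    also have "\<dots> = card S"
      by (simp add: S_def sum.If_cases Int_def conj_commute)
    finally show ?thesis .
  qed
  have "{..<i} \<subseteq> S" if "int k < lam i"
  proof -
    have "i \<le> N"
      using that N by (cases "i \<le> N") (auto simp: zero_beyond_def)
    with that show ?thesis
      using partition_antimono[OF lam, of "Suc _" i] by (auto simp: S_def intro: less_le_trans)
  qed
  moreover have "S \<subseteq> {..<i - 1}" if "\<not> int k < lam i"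
  proof
    fix j assume "j \<in> S"
    with that have "\<not> i \<le> Suc j"
      using partition_antimono[OF lam i, of "Suc j"] by (auto simp: S_def)
    then show "j \<in> {..<i - 1}"
      by auto
  qed
  moreover have "finite S"
    by (simp add: S_def)
  ultimately show ?thesis
    using card_mono[of S "{..<i}"] card_mono[of "{..<i - 1}" S] i unfolding card
    by (cases "int k < lam i") auto
qed

lemma mon_inject:
  assumes "is_partition lam" "zero_beyond N lam" "is_partition mu" "zero_beyond M mu"
    and "mon N lam = mon M mu" and i: "1 \<le> i"
  shows "lam i = mu i"
proof -
  have *: "int k < lam i \<longleftrightarrow> int k < mu i" for k
    using tailcount_mon_iff[OF assms(1,2) i] tailcount_mon_iff[OF assms(3,4) i] assms(5) by simp
  show ?thesis
    \<comment> \<open>A nonnegative integer is the least \<open>k\<close> that is not below it, so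
      testing at the two values is enough.\<close>
    using *[of "nat (lam i)"] *[of "nat (mu i)"]
      partition_nonneg[OF assms(1) i] partition_nonneg[OF assms(3) i] by simp
qed

lemma mon_surj: "\<exists>lam N. is_partition lam \<and> zero_beyond N lam \<and> mon N lam = e"
proof -
  obtain K where K: "tailcount K e = 0"
    using tailcount_eventually_0 by blast
  \<comment> \<open>The conjugate of the partition formed by the tail counts. At
    \<open>i = 0\<close> the set is infinite and its \<open>card\<close> is 0 by default.\<close>
  define lam where "lam i = int (card {k. i \<le> tailcount k e})" for i
  have fin: "finite {k. i \<le> tailcount k e}" if "1 \<le> i" for i
  proof (rule finite_subset)
    show "{k. i \<le> tailcount k e} \<subseteq> {..<K}"
      using tailcount_antimono[of K _ e] K that by (force simp: not_le)
  qed simp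
  have lam_iff: "int k < lam i \<longleftrightarrow> i \<le> tailcount k e" if i: "1 \<le> i" for i k
  proof -
    have "{..k} \<subseteq> {k. i \<le> tailcount k e}" if "i \<le> tailcount k e"
      using that tailcount_antimono[of _ k e] by (auto intro: order_trans)
    moreover have "{k. i \<le> tailcount k e} \<subseteq> {..<k}" if "\<not> i \<le> tailcount k e"
    proof
      fix k' assume "k' \<in> {k. i \<le> tailcount k e}"
      with that show "k' \<in> {..<k}"
        using tailcount_antimono[of k k' e] by (cases "k \<le> k'") auto
    qed
    ultimately show ?thesis
      using card_mono[OF fin[OF i], of "{..k}"] card_mono[of "{..<k}" "{k. i \<le> tailcount k e}"]
      unfolding lam_def by (cases "i \<le> tailcount k e") auto
  qed
  have zero: "zero_beyond (tailcount 0 e) lam"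
    unfolding zero_beyond_def
  proof (intro allI impI)
    fix i assume "i > tailcount 0 e"
    then have "\<not> int 0 < lam i"
      by (subst lam_iff) auto
    then show "lam i = 0"
      by (simp add: lam_def)
  qed
  moreover have part: "is_partition lam"
    unfolding is_partition_def
  proof (intro conjI allI impI)
    fix i :: nat assume i: "1 \<le> i"
    show "0 \<le> lam (i + 1)"
      by (simp add: lam_def)
    show "lam (i + 1) \<le> lam i"
      using i fin[OF i] unfolding lam_def by (auto intro!: card_mono)
  next
    show "\<exists>l. \<forall>i>l. lam i = 0"
      using zero by (auto simp: zero_beyond_def)
  qed
  moreover have "mon (tailcount 0 e) lam = e"
  proof (rule tailcount_inject)
    fix k
    have "i \<le> tailcount k (mon (tailcount 0 e) lam) \<longleftrightarrow> i \<le> tailcount k e" if "1 \<le> i" for i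
      using tailcount_mon_iff[OF part zero that] lam_iff[OF that] by simp
    then have "i \<le> tailcount k (mon (tailcount 0 e) lam) \<longleftrightarrow> i \<le> tailcount k e" for i
      by (cases "1 \<le> i") auto
    then show "tailcount k (mon (tailcount 0 e) lam) = tailcount k e"
      by (meson order_antisym order_refl)
  qed
  ultimately show ?thesis
    by blast
qed

text \<open>The order for which the monomial \<open>h\<^sub>\<lambda>\<close> is the greatest one in the character of \<open>\<lambda>\<close>.\<close>

definition exp_less :: "expo rel" where
  "exp_less = {(d, e). weight d < weight e \<or> weight d = weight e \<and> sqweight e < sqweight d}"

text \<open>At fixed weight \<open>w\<close> a descent increases \<open>sqweight\<close>, which is
  bounded by \<open>w^2\<close>; the gap to this bound is the second lexicographic
  component.\<close>

lemma wf_exp_less: "wf exp_less"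
proof (rule wf_subset)
  show "wf (inv_image (less_than <*lex*> less_than) (\<lambda>e. (weight e, (weight e)\<^sup>2 - sqweight e)))"
    by (intro wf_inv_image wf_lex_prod wf_less_than)
  show "exp_less \<subseteq> inv_image (less_than <*lex*> less_than) (\<lambda>e. (weight e, (weight e)\<^sup>2 - sqweight e))"
  proof (rule subrelI)
    fix d e assume "(d, e) \<in> exp_less"
    then show "(d, e) \<in> inv_image (less_than <*lex*> less_than) (\<lambda>e. (weight e, (weight e)\<^sup>2 - sqweight e))"
      using sqweight_le[of d] by (auto simp: exp_less_def)
  qed
qed

lemma exp_less_trans: "(a, b) \<in> exp_less \<Longrightarrow> (b, c) \<in> exp_less \<Longrightarrow> (a, c) \<in> exp_less"
  by (auto simp: exp_less_def)

lemma exp_less_irrefl: "(a, a) \<notin> exp_less"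
  by (auto simp: exp_less_def)

section \<open>Leading terms of the characters\<close>

definition Fdeg :: "int \<Rightarrow> symf set" where
  "Fdeg d = {f. \<forall>e\<in>Poly_Mapping.keys f. int (weight e) \<le> d}"

lemma Fdeg_mono: "f \<in> Fdeg d \<Longrightarrow> d \<le> d' \<Longrightarrow> f \<in> Fdeg d'"
  by (auto simp: Fdeg_def intro: order_trans)

lemma Fdeg_0 [simp]: "0 \<in> Fdeg d"
  by (simp add: Fdeg_def)

lemma Fdeg_add: "f \<in> Fdeg d \<Longrightarrow> f' \<in> Fdeg d \<Longrightarrow> f + f' \<in> Fdeg d"
  using Poly_Mapping.keys_add[of f f'] by (auto simp: Fdeg_def)

lemma Fdeg_uminus: "f \<in> Fdeg d \<Longrightarrow> - f \<in> Fdeg d"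
  by (auto simp: Fdeg_def in_keys_iff)

lemma Fdeg_mult:
  assumes "f \<in> Fdeg d" "f' \<in> Fdeg d'"
  shows "f * f' \<in> Fdeg (d + d')"
  unfolding Fdeg_def
proof safe
  fix e assume "e \<in> Poly_Mapping.keys (f * f')"
  then obtain a b where "e = a + b" "a \<in> Poly_Mapping.keys f" "b \<in> Poly_Mapping.keys f'"
    using Poly_Mapping.keys_mult[of f f'] by auto
  then show "int (weight e) \<le> d + d'"
    using assms by (auto simp: Fdeg_def wt_add intro: add_mono)
qed

text \<open>This includes negative \<open>a\<close>, where \<open>Fdeg a\<close> contains only
  0.\<close>

lemma hsym_Fdeg: "hsym a \<in> Fdeg a"
  by (cases "a < 0") (auto simp: hsym_eq_single Fdeg_def weight_hexp)

lemma J_lead: "J g a - hsym a \<in> Fdeg (a - 1)"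
  using Fdeg_uminus[OF Fdeg_mono[OF hsym_Fdeg[of "a - 2"]], of "a - 1"] by (cases g) (auto simp: J_def)

lemma J_Fdeg: "J g a \<in> Fdeg a"
  using Fdeg_add[OF Fdeg_mono[OF J_lead[of g a]] hsym_Fdeg[of a]] by simp

text \<open>For \<open>r \<ge> 1\<close> the second summand \<open>J g (a - r)\<close> has degree at
  most \<open>a - r\<close>, which is below \<open>a + r\<close>.\<close>

lemma hr_lead:
  assumes "0 \<le> r"
  shows "hr g r a - hsym (a + r) \<in> Fdeg (a + r - 1)"
proof (cases "r = 0")
  case False
  have "(J g (a + r) - hsym (a + r)) + J g (a - r) \<in> Fdeg (a + r - 1)"
    using assms False by (intro Fdeg_add J_lead Fdeg_mono[OF J_Fdeg]) auto
  with False assms show ?thesis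
    by (simp add: hr_def algebra_simps)
qed (simp add: hr_def J_lead)

lemma prod_lead:
  fixes f h :: "nat \<Rightarrow> symf"
  assumes lead: "\<And>i. i < n \<Longrightarrow> f i - h i \<in> Fdeg (d i - 1)" and deg: "\<And>i. i < n \<Longrightarrow> h i \<in> Fdeg (d i)"
  shows "(\<Prod>i<n. f i) - (\<Prod>i<n. h i) \<in> Fdeg ((\<Sum>i<n. d i) - 1)"
proof -
  \<comment> \<open>The induction also carries the degree of the product of the \<open>h i\<close>,
    which bounds the second term of the splitting
    \<open>(F - H) * f n + H * (f n - h n)\<close>.\<close>
  have "(\<Prod>i<n. f i) - (\<Prod>i<n. h i) \<in> Fdeg ((\<Sum>i<n. d i) - 1) \<and> (\<Prod>i<n. h i) \<in> Fdeg (\<Sum>i<n. d i)"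
    using assms
  proof (induction n)
    case 0
    then show ?case
      by (simp add: Fdeg_def)
  next
    case (Suc n)
    define F H D where "F = (\<Prod>i<n. f i)" "H = (\<Prod>i<n. h i)" "D = (\<Sum>i<n. d i)"
    have IH: "F - H \<in> Fdeg (D - 1)" "H \<in> Fdeg D"
      using Suc unfolding F_H_D_def by auto
    have fn: "f n \<in> Fdeg (d n)"
      using Fdeg_add[OF Fdeg_mono[OF Suc.prems(1)[of n]] Suc.prems(2)[of n]] by simp
    have "(F - H) * f n + H * (f n - h n) \<in> Fdeg (D + d n - 1)"
      using Fdeg_mult[OF IH(1) fn] Fdeg_mult[OF IH(2) Suc.prems(1)[of n]]
      by (intro Fdeg_add) (auto simp: algebra_simps)
    also have "(F - H) * f n + H * (f n - h n) = F * f n - H * h n"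
      by (simp add: algebra_simps)
    finally show ?case
      using Fdeg_mult[OF IH(2) Suc.prems(2)[of n]] unfolding F_H_D_def by simp
  qed
  then show ?thesis ..
qed

lemma prod_hsym:
  fixes n :: nat
  shows "(\<Prod>i<n. hsym (a i)) =
    (if \<exists>i<n. a i < 0 then 0 else Poly_Mapping.single (\<Sum>i<n. hexp (a i)) 1)"
  by (induction n) (auto simp: less_Suc_eq hsym_eq_single Poly_Mapping.mult_single)

section \<open>A rearrangement inequality for squares\<close>

lemma sum_lessThan_card_le:
  fixes A :: "nat set"
  assumes "finite A"
  shows "\<Sum>{..<card A} \<le> \<Sum>A"
  using assms
proof (induction "card A" arbitrary: A)
  case (Suc n)
  define m where "m = Max A"
  have m: "m \<in> A" "A \<subseteq> {..m}"
    using Suc.hyps(2) Suc.prems unfolding m_def by (auto simp: card_gt_0_iff intro!: Max_in)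
  \<comment> \<open>\<open>A\<close> lies in \<open>{..m}\<close>, so its maximum is at least
    \<open>card A - 1\<close>.\<close>
  have "card A \<le> card {..m}"
    using m by (intro card_mono) auto
  moreover have "\<Sum>{..<n} \<le> \<Sum>(A - {m})"
    using Suc.hyps(1)[of "A - {m}"] Suc.hyps(2)[symmetric] Suc.prems m by simp
  ultimately show ?case
    using Suc.hyps(2)[symmetric] Suc.prems m by (simp add: sum.remove)
qed simp

lemma abel_sum_nonneg:
  fixes x d :: "nat \<Rightarrow> int"
  assumes "\<And>i. i < n \<Longrightarrow> 0 \<le> x i" "\<And>i. Suc i < n \<Longrightarrow> x (Suc i) \<le> x i"
    and "\<And>m. m \<le> n \<Longrightarrow> 0 \<le> (\<Sum>i<m. d i)"
  shows "0 \<le> (\<Sum>i<n. x i * d i)"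
proof -
  \<comment> \<open>Abel summation as an induction: the weighted partial sum dominates the last,
    smallest weight times the plain partial sum.\<close>
  have "x m * (\<Sum>i<Suc m. d i) \<le> (\<Sum>i<Suc m. x i * d i)" if "m < n" for m
    using that
  proof (induction m)
    case (Suc m)
    have "x (Suc m) * (\<Sum>i<Suc m. d i) \<le> x m * (\<Sum>i<Suc m. d i)"
      using Suc.prems assms by (intro mult_right_mono) (auto simp del: sum.lessThan_Suc)
    with Suc show ?case
      by (simp add: algebra_simps)
  qed simp
  from this[of "n - 1"] show ?thesis
    using assms(1)[of "n - 1"] assms(3)[of n] by (cases n) (auto intro: order_trans[rotated])
qed

text \<open>Expanding the squares leaves \<open>\<Sum>(p i - i)\<^sup>2\<close>, which is positive, and
  \<open>2\<Sum>x\<^sub>i(p i - i)\<close>, which is nonnegative as the partial sums of \<open>p i - i\<close> are.\<close>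

lemma sum_squares_permuted:
  fixes x :: "nat \<Rightarrow> int"
  assumes x: "\<And>i. i < n \<Longrightarrow> 0 \<le> x i" "\<And>i. Suc i < n \<Longrightarrow> x (Suc i) \<le> x i"
    and p: "p permutes {0..<n}" "p \<noteq> id"
  shows "(\<Sum>i<n. (x i)\<^sup>2) < (\<Sum>i<n. (x i - int i + int (p i))\<^sup>2)"
proof -
  have "0 \<le> (\<Sum>i<n. x i * (int (p i) - int i))"
  proof (rule abel_sum_nonneg)
    fix m
    \<comment> \<open>\<open>p\<close> takes \<open>m\<close> distinct values on
      \<open>{..<m}\<close>, and these sum to at least \<open>0 + ... + (m - 1)\<close>.\<close>
    have "card (p ` {..<m}) = m"
      using permutes_inj[OF p(1)] by (subst card_image) (auto intro: inj_on_subset)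
    then have "\<Sum>{..<m} \<le> (\<Sum>i<m. p i)"
      using sum_lessThan_card_le[of "p ` {..<m}"] permutes_inj[OF p(1)]
      by (simp add: sum.reindex inj_on_subset)
    then show "0 \<le> (\<Sum>i<m. int (p i) - int i)"
      by (simp add: sum_subtractf flip: of_nat_sum)
  qed (use x in auto)
  moreover obtain j where "p j \<noteq> j"
    using p(2) by (auto simp: fun_eq_iff)
  then have "0 < (\<Sum>i<n. (int (p i) - int i)\<^sup>2)"
    using permutes_not_in[OF p(1), of j] by (intro sum_pos2[of _ j]) auto
  moreover have "(\<Sum>i<n. (x i - int i + int (p i))\<^sup>2) = (\<Sum>i<n. (x i)\<^sup>2) +
      2 * (\<Sum>i<n. x i * (int (p i) - int i)) + (\<Sum>i<n. (int (p i) - int i)\<^sup>2)"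
    by (simp add: sum_distrib_left flip: sum.distrib) (simp add: power2_eq_square algebra_simps)
  ultimately show ?thesis
    by simp
qed

section \<open>Triangularity of the characters\<close>

definition Low :: "expo \<Rightarrow> symf set" where
  "Low e0 = {f. \<forall>e\<in>Poly_Mapping.keys f. (e, e0) \<in> exp_less}"

lemma Low_add: "f \<in> Low e \<Longrightarrow> f' \<in> Low e \<Longrightarrow> f + f' \<in> Low e"
  using Poly_Mapping.keys_add[of f f'] by (auto simp: Low_def)

lemma Low_uminus: "f \<in> Low e \<Longrightarrow> - f \<in> Low e"
  by (auto simp: Low_def in_keys_iff)

lemma Low_signof: "f \<in> Low e \<Longrightarrow> signof p * f \<in> Low e"
  using Low_uminus[of f e] by (simp add: sign_def)

lemma Low_0 [simp]: "0 \<in> Low e"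
  by (simp add: Low_def)

lemma Low_sum: "(\<And>i. i \<in> A \<Longrightarrow> f i \<in> Low e) \<Longrightarrow> (\<Sum>i\<in>A. f i) \<in> Low e"
  by (induction A rule: infinite_finite_induct) (auto intro: Low_add)

lemma schar_lead:
  assumes lam: "is_partition lam" and N: "zero_beyond N lam"
  shows "schar g lam - Poly_Mapping.single (mon N lam) 1 \<in> Low (mon N lam)"
proof -
  let ?e = "mon N lam"
  let ?P = "{p. p permutes {0..<N}}"
  \<comment> \<open>\<open>a p i\<close> is the index of the leading \<open>h\<close> in row
    \<open>i\<close>, column \<open>p i\<close>; \<open>f p\<close> is the Leibniz product along
    \<open>p\<close>, and \<open>h p\<close> the product of the leading terms.\<close>
  define a where "a p i = lam (Suc i) - int i + int (p i)" for p :: "nat \<Rightarrow> nat" and i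
  define f where "f p = (\<Prod>i<N. hr g (int (p i)) (lam (Suc i) - int i))" for p :: "nat \<Rightarrow> nat"
  define h where "h p = (\<Prod>i<N. hsym (a p i))" for p
  have nonneg: "0 \<le> lam (Suc i)" for i
    using partition_nonneg[OF lam, of "Suc i"] by simp
  have weight_e: "int (weight ?e) = (\<Sum>i<N. lam (Suc i))"
    using nonneg by (simp add: mon_def wt_sum weight_hexp)
  have sqweight_e: "int (sqweight ?e) = (\<Sum>i<N. (lam (Suc i))\<^sup>2)"
    using nonneg by (simp add: mon_def wt_sum sqweight_hexp)
  \<comment> \<open>A permutation of the columns keeps the sum of the indices, so all nonzero
    \<open>h p\<close> have the same weight.\<close>
  have sum_a: "(\<Sum>i<N. a p i) = int (weight ?e)" if "p \<in> ?P" for p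
  proof -
    have "(\<Sum>i<N. int (p i)) = (\<Sum>i<N. int i)"
      using sum.permute[of p "{0..<N}" int] that by (simp add: lessThan_atLeast0 comp_def)
    then show ?thesis
      by (simp add: a_def weight_e sum.distrib sum_subtractf)
  qed
  have fh: "f p - h p \<in> Low ?e" if "p \<in> ?P" for p
  proof -
    have "f p - h p \<in> Fdeg (int (weight ?e) - 1)"
      unfolding f_def h_def sum_a[OF that, symmetric]
      by (intro prod_lead hsym_Fdeg) (use hr_lead in \<open>simp add: a_def\<close>)
    then show ?thesis
      by (auto simp: Fdeg_def Low_def exp_less_def)
  qed
  have h: "h p \<in> Low ?e" if "p \<in> ?P" "p \<noteq> id" for p
  \<comment> \<open>One negative index makes \<open>h p\<close> zero; otherwise it is a monomial
    whose larger sum of squares puts it below \<open>mon N lam\<close>.\<close>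
  proof (cases "\<exists>i<N. a p i < 0")
    case True
    then show ?thesis
      by (simp add: h_def prod_hsym)
  next
    case False
    define d where "d = (\<Sum>i<N. hexp (a p i))"
    have nn: "0 \<le> a p i" if "i < N" for i
      using False that by (meson not_less)
    then have "int (weight d) = (\<Sum>i<N. a p i)"
      by (simp add: d_def wt_sum weight_hexp cong: sum.cong_simp)
    then have "int (weight d) = int (weight ?e)"
      using sum_a[OF that(1)] by simp
    moreover have "int (sqweight ?e) < int (sqweight d)"
    proof -
      have "(\<Sum>i<N. (lam (Suc i))\<^sup>2) < (\<Sum>i<N. (lam (Suc i) - int i + int (p i))\<^sup>2)"
        using that nonneg partition_antimono[OF lam] by (intro sum_squares_permuted) auto
      then show ?thesis
        using nn by (simp add: d_def wt_sum sqweight_hexp sqweight_e a_def cong: sum.cong_simp)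
    qed
    ultimately have "(d, ?e) \<in> exp_less"
      by (simp add: exp_less_def)
    then show ?thesis
      using False by (simp add: h_def prod_hsym Low_def d_def)
  qed
  have h_id: "h id = Poly_Mapping.single ?e 1"
    using nonneg by (simp add: h_def prod_hsym a_def mon_def flip: not_le)
  have "schar g lam = (\<Sum>p\<in>?P. signof p * f p)"
    unfolding schar_eq_jacobi_trudi[OF N order_refl] jacobi_trudi_def f_def
    by (subst det_def'[of _ N])
       (auto simp: lessThan_atLeast0 Let_def permutes_in_image[of _ "{0..<N}", simplified]
         intro!: sum.cong prod.cong)
  also have "\<dots> = (\<Sum>p\<in>?P. signof p * (f p - h p)) + (\<Sum>p\<in>?P. signof p * h p)"
    by (simp add: algebra_simps flip: sum.distrib)
  also have "(\<Sum>p\<in>?P. signof p * h p) = Poly_Mapping.single ?e 1 + (\<Sum>p\<in>?P - {id}. signof p * h p)"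
    by (subst sum.remove[of _ id]) (auto simp: h_id finite_permutations)
  finally have "schar g lam - Poly_Mapping.single ?e 1 =
      (\<Sum>p\<in>?P. signof p * (f p - h p)) + (\<Sum>p\<in>?P - {id}. signof p * h p)"
    by simp
  also have "\<dots> \<in> Low ?e"
    using fh h by (intro Low_add Low_sum) (auto intro: Low_signof)
  finally show ?thesis .
qed

section \<open>Linear maps prescribed on the characters\<close>

lemma lookup_scaleB [simp]: "Poly_Mapping.lookup (scaleB c f) e = c * Poly_Mapping.lookup f e"
  by (auto simp: scaleB_def map.rep_eq when_def simp flip: mult_map_scale_conv_mult)

lemma inB_eq_single_mult: "inB f * F = Poly_Mapping.map ((*) f) F"
  by (simp add: inB_def mult_map_scale_conv_mult)

lemma lookup_inB_mult [simp]: "Poly_Mapping.lookup (inB f * F) n = f * Poly_Mapping.lookup F n"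
  by (auto simp: inB_eq_single_mult map.rep_eq when_def)

lemma lookup_scaleF [simp]:
  "Poly_Mapping.lookup (scaleF c F) n = scaleB c (Poly_Mapping.lookup F n)"
  by (simp add: scaleF_def scaleB_def)

interpretation B: vector_space scaleB
  by unfold_locales (auto intro!: poly_mapping_eqI simp: lookup_add algebra_simps)

interpretation F: vector_space scaleF
  by unfold_locales
     (auto intro!: poly_mapping_eqI simp: lookup_add algebra_simps)

section \<open>The characters as a basis of \<open>B\<close>\<close>

definition part_of :: "expo \<Rightarrow> nat \<Rightarrow> int" where
  "part_of e = (SOME lam. \<exists>N. is_partition lam \<and> zero_beyond N lam \<and> mon N lam = e)"

lemma part_of: "\<exists>N. is_partition (part_of e) \<and> zero_beyond N (part_of e) \<and> mon N (part_of e) = e"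
  using someI_ex[OF mon_surj[of e]] unfolding part_of_def .

lemma is_partition_part_of: "is_partition (part_of e)"
  using part_of by blast

text \<open>The value of a partition at the index 0 is arbitrary, so only the other values are determined.\<close>

lemma partition_eq_part_of:
  assumes "is_partition lam"
  shows "\<exists>e. \<forall>i\<ge>1. lam i = part_of e i"
proof -
  obtain N where N: "zero_beyond N lam"
    using is_partition_zero_beyond[OF assms] by blast
  obtain M where M: "is_partition (part_of (mon N lam))" "zero_beyond M (part_of (mon N lam))"
      "mon M (part_of (mon N lam)) = mon N lam"
    using part_of by blast
  show ?thesis
    using mon_inject[OF assms N M(1,2) M(3)[symmetric]] by blast
qed

text \<open>Indexing by exponents instead of functions \<open>lam\<close> makes the family
  injective, since the entry at index 0 is then fixed by choice.\<close>

definition sbasis :: "lie_type \<Rightarrow> expo \<Rightarrow> symf" where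
  "sbasis g e = schar g (part_of e)"

lemma sbasis_lead: "sbasis g e - Poly_Mapping.single e 1 \<in> Low e"
  using part_of[of e] schar_lead[of "part_of e" _ g] unfolding sbasis_def by metis

lemma lookup_sbasis_self: "Poly_Mapping.lookup (sbasis g e) e = 1"
proof -
  have "Poly_Mapping.lookup (sbasis g e - Poly_Mapping.single e 1) e = 0"
    using sbasis_lead[of g e] exp_less_irrefl[of e]
    by (auto simp: Low_def in_keys_iff )
  then show ?thesis
    by (simp add: lookup_minus)
qed

lemma lookup_sbasis_other:
  assumes "d \<noteq> e" "(d, e) \<notin> exp_less"
  shows "Poly_Mapping.lookup (sbasis g e) d = 0"
proof -
  have "Poly_Mapping.lookup (sbasis g e - Poly_Mapping.single e 1) d = 0"
    using sbasis_lead[of g e] assms by (auto simp: Low_def in_keys_iff)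
  then show ?thesis
    using assms by (simp add: lookup_minus lookup_single)
qed

text \<open>Equal characters would each contain the leading monomial of the other, so each exponent
  would lie strictly below the other.\<close>

lemma inj_sbasis: "inj (sbasis g)"
proof (rule injI, rule ccontr)
  fix d e assume eq: "sbasis g d = sbasis g e" and "d \<noteq> e"
  then have "(d, e) \<in> exp_less" "(e, d) \<in> exp_less"
    using lookup_sbasis_other[of d e g] lookup_sbasis_other[of e d g]
      lookup_sbasis_self[of g d] lookup_sbasis_self[of g e] by auto
  then show False
    using exp_less_trans exp_less_irrefl by blast
qed

text \<open>In a vanishing linear combination, the coefficient of a maximal character is isolated
  by comparing the coefficients of its leading monomial.\<close>

lemma independent_sbasis: "B.independent (range (sbasis g))"
  unfolding B.dependent_explicit
proof (rule notI, elim exE conjE bexE)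
  fix t u b
  assume t: "finite t" "t \<subseteq> range (sbasis g)" "(\<Sum>v\<in>t. scaleB (u v) v) = 0"
    and b: "b \<in> t" "u b \<noteq> 0"
  define S where "S = {e. sbasis g e \<in> t \<and> u (sbasis g e) \<noteq> 0}"
  have "finite S"
    using finite_vimageI[OF t(1) inj_sbasis[of g]] by (rule rev_finite_subset) (auto simp: S_def)
  \<comment> \<open>The converse of \<open>exp_less\<close> is well founded only after restriction
    to the finite set \<open>S\<close>; this gives the maximal element \<open>m\<close>.\<close>
  have "wf (exp_less\<inverse> \<inter> S \<times> S)"
  proof (rule finite_acyclic_wf)
    show "finite (exp_less\<inverse> \<inter> S \<times> S)"
      using \<open>finite S\<close> by blast
    have "trans exp_less"
      using exp_less_trans by (rule transI)
    then have "acyclic exp_less"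
      by (simp add: acyclic_def exp_less_irrefl)
    then show "acyclic (exp_less\<inverse> \<inter> S \<times> S)"
      using acyclic_subset[of "exp_less\<inverse>" "exp_less\<inverse> \<inter> S \<times> S"] by simp
  qed
  moreover obtain e0 where "e0 \<in> S"
    using t(2) b unfolding S_def by blast
  ultimately obtain m where m: "m \<in> S" and "\<And>e. (e, m) \<in> exp_less\<inverse> \<inter> S \<times> S \<Longrightarrow> e \<notin> S"
    by (rule wfE_min) blast
  then have max: "(m, e) \<notin> exp_less" if "e \<in> S" for e
    using that by blast
  \<comment> \<open>Any other character has coefficient 0 or, by maximality of \<open>m\<close>,
    does not contain the monomial \<open>m\<close>.\<close>
  have other: "Poly_Mapping.lookup (scaleB (u v) v) m = 0" if "v \<in> t - {sbasis g m}" for v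
  proof -
    from that t(2) obtain e where e: "v = sbasis g e"
      by blast
    show ?thesis
    proof (cases "e \<in> S")
      case True
      with that e have "Poly_Mapping.lookup v m = 0"
        using lookup_sbasis_other[of m e g] max by fastforce
      then show ?thesis
        by simp
    next
      case False
      with that e show ?thesis
        by (simp add: S_def)
    qed
  qed
  have "0 = (\<Sum>v\<in>t. Poly_Mapping.lookup (scaleB (u v) v) m)"
    unfolding lookup_sum[symmetric] t(3) by simp
  also have "\<dots> = Poly_Mapping.lookup (scaleB (u (sbasis g m)) (sbasis g m)) m"
    using m t(1) other by (subst sum.remove[of t "sbasis g m"]) (auto simp: S_def simp del: lookup_scaleB)
  finally show False
    using m by (simp add: S_def lookup_sbasis_self)
qed

lemma symf_eq_sum: "f = (\<Sum>e\<in>Poly_Mapping.keys f. scaleB (Poly_Mapping.lookup f e) (Poly_Mapping.single e 1))"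
  by (rule poly_mapping_eqI)
     (auto simp: lookup_sum lookup_single when_def in_keys_iff if_distrib cong: if_cong)

text \<open>Well-founded induction on exponents: a monomial is its character minus a remainder made
  of smaller monomials, which already lie in the span.\<close>

lemma span_sbasis: "B.span (range (sbasis g)) = UNIV"
proof -
  have mon: "Poly_Mapping.single e 1 \<in> B.span (range (sbasis g))" for e
    using wf_exp_less
  proof (induction e rule: wf_induct_rule)
    case (less e)
    define r where "r = sbasis g e - Poly_Mapping.single e 1"
    have "scaleB (Poly_Mapping.lookup r d) (Poly_Mapping.single d 1) \<in> B.span (range (sbasis g))"
      if "d \<in> Poly_Mapping.keys r" for d
      using less.IH[of d] sbasis_lead[of g e] that by (auto simp: r_def Low_def intro: B.span_scale)
    then have "r \<in> B.span (range (sbasis g))"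
      by (subst symf_eq_sum[of r]) (rule B.span_sum)
    then have "sbasis g e - r \<in> B.span (range (sbasis g))"
      by (intro B.span_diff) (auto intro: B.span_base)
    then show ?case
      by (simp add: r_def)
  qed
  have "f \<in> B.span (range (sbasis g))" for f
    by (subst symf_eq_sum[of f]) (intro B.span_sum B.span_scale mon)
  then show ?thesis
    by auto
qed

section \<open>Induction over the basis and linear extension from it\<close>

lemma symf_induct [case_names schar add scale]:
  assumes "\<And>lam. is_partition lam \<Longrightarrow> P (schar g lam)"
    and add: "\<And>f f'. P f \<Longrightarrow> P f' \<Longrightarrow> P (f + f')" and scale: "\<And>c f. P f \<Longrightarrow> P (scaleB c f)"
  shows "P f"
proof -
  have "f \<in> B.span (range (sbasis g))"
    by (simp add: span_sbasis)
  then show ?thesis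
  proof (induction rule: B.span_induct_alt)
    case base
    \<comment> \<open>The zero element needs no case of its own, being the zero multiple of a
      character.\<close>
    have "P (scaleB 0 (sbasis g 0))"
      by (intro scale) (simp add: sbasis_def assms is_partition_part_of)
    then show ?case
      by simp
  next
    case (step c x y)
    then show ?case
      by (auto intro!: add scale simp: sbasis_def assms is_partition_part_of)
  qed
qed

text \<open>The target is arbitrary because maps on the boson space are built from maps of
  \<open>B\<close> into it, one per charge. The hypothesis \<open>cong\<close> makes
  \<open>v\<close> independent of the entry at index 0.\<close>

lemma linear_schar_ex:
  assumes "vector_space s"
    and cong: "\<And>lam mu. (\<And>i. i \<ge> 1 \<Longrightarrow> lam i = mu i) \<Longrightarrow> v lam = v mu"
  shows "\<exists>T. Vector_Spaces.linear scaleB s T \<and> (\<forall>lam. is_partition lam \<longrightarrow> T (schar g lam) = v lam)"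
proof -
  interpret S: vector_space s by fact
  interpret vector_space_pair scaleB s by unfold_locales
  obtain T where T: "Vector_Spaces.linear scaleB s T"
      "\<And>x. x \<in> range (sbasis g) \<Longrightarrow> T x = v (part_of (inv_into UNIV (sbasis g) x))"
    using linear_independent_extend[OF independent_sbasis[of g],
        of "\<lambda>x. v (part_of (inv_into UNIV (sbasis g) x))"] by blast
  have "T (schar g lam) = v lam" if lam: "is_partition lam" for lam
  proof -
    obtain e where e: "\<And>i. i \<ge> 1 \<Longrightarrow> lam i = part_of e i"
      using partition_eq_part_of[OF lam] by auto
    have "schar g lam = sbasis g e"
      unfolding sbasis_def using e by (rule schar_cong)
    moreover have "v lam = v (part_of e)"
      using e by (rule cong)
    ultimately show ?thesis
      by (simp add: T(2) inv_f_f inj_sbasis)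
  qed
  with T(1) show ?thesis
    by blast
qed

lemma linear_schar_unique:
  assumes "Vector_Spaces.linear scaleB s T" "Vector_Spaces.linear scaleB s T'"
    and "\<And>lam. is_partition lam \<Longrightarrow> T (schar g lam) = T' (schar g lam)"
  shows "T = T'"
proof
  fix f
  show "T f = T' f"
    by (induction f rule: symf_induct[of _ g]) (use assms in \<open>auto simp: Vector_Spaces.linear_iff\<close>)
qed

lemma linear_schar_ex1:
  assumes "\<And>lam mu. (\<And>i. i \<ge> 1 \<Longrightarrow> lam i = mu i) \<Longrightarrow> v lam = v mu"
  shows "\<exists>!T. Vector_Spaces.linear scaleB scaleB T \<and> (\<forall>lam. is_partition lam \<longrightarrow> T (schar g lam) = v lam)"
proof (rule ex_ex1I)
  show "\<exists>T. Vector_Spaces.linear scaleB scaleB T \<and> (\<forall>lam. is_partition lam \<longrightarrow> T (schar g lam) = v lam)"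
    by (rule linear_schar_ex[OF B.vector_space_axioms assms])
next
  fix T T'
  assume "Vector_Spaces.linear scaleB scaleB T \<and> (\<forall>lam. is_partition lam \<longrightarrow> T (schar g lam) = v lam)"
    and "Vector_Spaces.linear scaleB scaleB T' \<and> (\<forall>lam. is_partition lam \<longrightarrow> T' (schar g lam) = v lam)"
  then show "T = T'"
    by (intro linear_schar_unique[of scaleB T T' g]) simp_all
qed

lemma inB_mult_zpow: "inB f * zpow m = Poly_Mapping.single m f"
  by (simp add: inB_def zpow_def Poly_Mapping.mult_single)

lemma fock_eq_sum: "F = (\<Sum>m\<in>Poly_Mapping.keys F. Poly_Mapping.single m (Poly_Mapping.lookup F m))"
  by (rule poly_mapping_eqI)
     (auto simp: lookup_sum lookup_single when_def in_keys_iff if_distrib cong: if_cong)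

lemma scaleB_single: "Poly_Mapping.single m (scaleB c f) = scaleF c (Poly_Mapping.single m f)"
  by (rule poly_mapping_eqI) (simp add: lookup_single when_def)

text \<open>The boson space is the direct sum of its charge components, so a linear map on it
  amounts to one linear map on \<open>B\<close> for each charge.\<close>

lemma linear_fock_ex1:
  fixes v :: "(nat \<Rightarrow> int) \<Rightarrow> int \<Rightarrow> fock"
  assumes cong: "\<And>lam mu m. (\<And>i. i \<ge> 1 \<Longrightarrow> lam i = mu i) \<Longrightarrow> v lam m = v mu m"
  shows "\<exists>!T. Vector_Spaces.linear scaleF scaleF T \<and>
    (\<forall>lam m. is_partition lam \<longrightarrow> T (inB (schar g lam) * zpow m) = v lam m)"
proof (rule ex_ex1I)
  have "\<forall>m. \<exists>T. Vector_Spaces.linear scaleB scaleF T \<and>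
      (\<forall>lam. is_partition lam \<longrightarrow> T (schar g lam) = v lam m)"
    using cong by (intro allI linear_schar_ex F.vector_space_axioms) blast
  then obtain L where lin: "\<And>m. Vector_Spaces.linear scaleB scaleF (L m)"
    and L: "\<And>m lam. is_partition lam \<Longrightarrow> L m (schar g lam) = v lam m"
    by metis
  have L_add: "L m (f + f') = L m f + L m f'" and L_scale: "L m (scaleB c f) = scaleF c (L m f)" for m f f' c
    using lin by (auto simp: Vector_Spaces.linear_iff)
  have L_0: "L m 0 = 0" for m
    using L_scale[of m 0 0] by simp
  \<comment> \<open>Finite on each \<open>F\<close>: charges outside its support contribute
    \<open>L m 0 = 0\<close>.\<close>
  define T where "T F = Sum_any (\<lambda>m. L m (Poly_Mapping.lookup F m))" for F
  have fin: "finite {m. L m (Poly_Mapping.lookup F m) \<noteq> 0}" for F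
    by (rule finite_subset[of _ "Poly_Mapping.keys F"]) (auto simp: in_keys_iff L_0)
  have "T (F + G) = T F + T G" for F G
    unfolding T_def by (subst Sum_any.distrib[symmetric]) (simp_all add: fin lookup_add L_add)
  moreover have "T (scaleF c F) = scaleF c (T F)" for c F
  proof -
    have "T (scaleF c F) = Sum_any (\<lambda>m. inB (Poly_Mapping.single 0 c) * L m (Poly_Mapping.lookup F m))"
      by (simp add: T_def L_scale flip: scaleF_def)
    also have "\<dots> = scaleF c (T F)"
      unfolding T_def scaleF_def by (rule Sum_any_right_distrib[OF fin, symmetric])
    finally show ?thesis .
  qed
  moreover have "T (Poly_Mapping.single m f) = L m f" for m f
  proof -
    have "L n (Poly_Mapping.lookup (Poly_Mapping.single m f) n) = (L n f when n = m)" for n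
      by (simp add: lookup_single when_def L_0)
    then show ?thesis
      by (simp add: T_def)
  qed
  ultimately show "\<exists>T. Vector_Spaces.linear scaleF scaleF T \<and>
      (\<forall>lam m. is_partition lam \<longrightarrow> T (inB (schar g lam) * zpow m) = v lam m)"
    by (intro exI[of _ T])
       (simp add: Vector_Spaces.linear_iff F.vector_space_axioms inB_mult_zpow L)
next
  fix T T'
  assume T: "Vector_Spaces.linear scaleF scaleF T \<and>
      (\<forall>lam m. is_partition lam \<longrightarrow> T (inB (schar g lam) * zpow m) = v lam m)"
    and T': "Vector_Spaces.linear scaleF scaleF T' \<and>
      (\<forall>lam m. is_partition lam \<longrightarrow> T' (inB (schar g lam) * zpow m) = v lam m)"
  interpret T: Vector_Spaces.linear scaleF scaleF T using T by blast
  interpret T': Vector_Spaces.linear scaleF scaleF T' using T' by blast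
  have single: "T (Poly_Mapping.single m f) = T' (Poly_Mapping.single m f)" for m f
  proof (induction f rule: symf_induct[of _ g])
    case (schar lam)
    with T T' show ?case
      by (simp add: inB_mult_zpow)
  qed (simp_all add: single_add T.add T'.add scaleB_single T.scale T'.scale)
  show "T = T'"
  proof
    fix F
    have "T F = T (\<Sum>m\<in>Poly_Mapping.keys F. Poly_Mapping.single m (Poly_Mapping.lookup F m))"
      by (rule arg_cong[OF fock_eq_sum])
    also have "\<dots> = T' (\<Sum>m\<in>Poly_Mapping.keys F. Poly_Mapping.single m (Poly_Mapping.lookup F m))"
      by (simp add: T.sum T'.sum single)
    also have "\<dots> = T' F"
      by (rule arg_cong[OF fock_eq_sum[symmetric]])
    finally show "T F = T' F" .
  qed
qed

section \<open>The operators\<close>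

text \<open>The least admissible length serves only to obtain a function of \<open>lam\<close>;
  every admissible length gives the same value.\<close>

definition dlow_val :: "lie_type \<Rightarrow> int \<Rightarrow> (nat \<Rightarrow> int) \<Rightarrow> symf" where
  "dlow_val g p lam = dlow g p lam (LEAST l. zero_beyond l lam)"

lemma dlow_val_eq: "zero_beyond l lam \<Longrightarrow> dlow_val g p lam = dlow g p lam l"
  unfolding dlow_val_def by (rule dlow_stable[OF LeastI])

lemma dlow_val_cong:
  assumes "\<And>i. i \<ge> 1 \<Longrightarrow> lam i = mu i"
  shows "dlow_val g p lam = dlow_val g p mu"
proof -
  have "zero_beyond l lam = zero_beyond l mu" for l
    using assms by (auto simp: zero_beyond_def)
  then show ?thesis
    unfolding dlow_val_def using assms by (simp add: dlow_cong[of lam mu])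
qed

text \<open>\<open>Dlow\<close> prescribes a value for all admissible lengths at once. Stability in
  the length makes these agree, which reduces existence to \<open>linear_schar_ex1\<close>.\<close>

lemma Dlow_altdef:
  "Dlow g p = (THE T. Vector_Spaces.linear scaleB scaleB T \<and>
     (\<forall>lam. is_partition lam \<longrightarrow> T (schar g lam) = dlow_val g p lam))"
proof -
  have "(if 0 \<le> p \<and> p \<le> int l then
             det (mat l l (\<lambda>(i0, j0).
               let i = i0 + 1; j = (if int j0 < p then j0 else j0 + 1)
               in hr g (int j) (lam i - int i)))
           else 0) = dlow g p lam l" for lam l
    by (cases p) (simp_all add: dlow_def dlow_mat_def Let_def cong: if_cong)
  moreover have "(\<forall>lam l. is_partition lam \<and> (\<forall>i>l. lam i = 0) \<longrightarrow> T (schar g lam) = dlow g p lam l) \<longleftrightarrow>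
      (\<forall>lam. is_partition lam \<longrightarrow> T (schar g lam) = dlow_val g p lam)" for T
  proof (intro iffI allI impI)
    fix lam assume L: "\<forall>lam l. is_partition lam \<and> (\<forall>i>l. lam i = 0) \<longrightarrow> T (schar g lam) = dlow g p lam l"
      and lam: "is_partition lam"
    obtain l where l: "zero_beyond l lam"
      using is_partition_zero_beyond[OF lam] by blast
    with L lam show "T (schar g lam) = dlow_val g p lam"
      by (simp add: dlow_val_eq[OF l] zero_beyond_def)
  next
    fix lam l assume "\<forall>lam. is_partition lam \<longrightarrow> T (schar g lam) = dlow_val g p lam"
      and "is_partition lam \<and> (\<forall>i>l. lam i = 0)"
    then show "T (schar g lam) = dlow g p lam l"
      using dlow_val_eq[of l lam g p] by (simp add: zero_beyond_def)
  qed
  ultimately show ?thesis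
    by (simp only: Dlow_def)
qed

lemma Dlow_unique:
  "\<exists>!T. Vector_Spaces.linear scaleB scaleB T \<and>
     (\<forall>lam. is_partition lam \<longrightarrow> T (schar g lam) = dlow_val g p lam)"
  by (rule linear_schar_ex1) (rule dlow_val_cong)

lemma linear_Dlow: "Vector_Spaces.linear scaleB scaleB (Dlow g p)"
  unfolding Dlow_altdef by (rule conjunct1[OF theI'[OF Dlow_unique]])

lemma Dlow_schar:
  assumes "is_partition lam" "zero_beyond l lam"
  shows "Dlow g p (schar g lam) = dlow g p lam l"
  unfolding Dlow_altdef dlow_val_eq[OF assms(2), symmetric]
  using assms(1) by (rule conjunct2[OF theI'[OF Dlow_unique[of g p]], THEN spec, THEN mp])

section \<open>The operators \<open>D^(p)\<close>\<close>

lemma remove_part_cong: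
  assumes "\<And>i. i \<ge> 1 \<Longrightarrow> lam i = mu i" "i \<ge> 1"
  shows "remove_part t lam i = remove_part t mu i"
  using assms by (simp add: remove_part_def)

lemma Dup_unique:
  "\<exists>!T. Vector_Spaces.linear scaleB scaleB T \<and>
     (\<forall>lam. is_partition lam \<longrightarrow>
        T (schar g lam) =
          Sum_any (\<lambda>t. (- 1) ^ (t + 1) * hr g p (lam t - int t + 2) * schar g (remove_part t lam)
            when t \<ge> 1))"
proof (rule linear_schar_ex1)
  fix lam mu :: "nat \<Rightarrow> int"
  assume "\<And>i. i \<ge> 1 \<Longrightarrow> lam i = mu i"
  then show "Sum_any (\<lambda>t. (- 1) ^ (t + 1) * hr g p (lam t - int t + 2) * schar g (remove_part t lam)
            when t \<ge> 1) =
        Sum_any (\<lambda>t. (- 1) ^ (t + 1) * hr g p (mu t - int t + 2) * schar g (remove_part t mu)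
            when t \<ge> 1)"
    using schar_cong[OF remove_part_cong[of lam mu]] by (intro Sum_any.cong when_cong) auto
qed

lemma linear_Dup: "Vector_Spaces.linear scaleB scaleB (Dup g p)"
  unfolding Dup_def by (rule conjunct1[OF theI'[OF Dup_unique]])

lemma Dup_schar_Sum_any:
  "is_partition lam \<Longrightarrow> Dup g p (schar g lam) =
    Sum_any (\<lambda>t. (- 1) ^ (t + 1) * hr g p (lam t - int t + 2) * schar g (remove_part t lam)
            when t \<ge> 1)"
  unfolding Dup_def by (rule conjunct2[OF theI'[OF Dup_unique], THEN spec, THEN mp])

lemma Dup_schar:
  assumes "is_partition lam" "zero_beyond l lam" "l < N" "\<bar>p\<bar> + 2 \<le> int N"
  shows "Dup g p (schar g lam) =
    (\<Sum>t = 1..N. (- 1) ^ (t + 1) * hr g p (lam t - int t + 2) * schar g (remove_part t lam))"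
proof -
  \<comment> \<open>Here \<open>lam t = 0\<close>, and both \<open>2 - t + p\<close> and
    \<open>2 - t - p\<close> are negative.\<close>
  have "hr g p (lam t - int t + 2) = 0" if "t > N" for t
    using that assms by (simp add: zero_beyond_def hr_def)
  then have "{t. ((- 1) ^ (t + 1) * hr g p (lam t - int t + 2) * schar g (remove_part t lam) when t \<ge> 1) \<noteq> 0}
      \<subseteq> {1..N}"
    by (intro subsetI) (rule ccontr, simp)
  then have "Dup g p (schar g lam) =
    (\<Sum>t = 1..N. (- 1) ^ (t + 1) * hr g p (lam t - int t + 2) * schar g (remove_part t lam)
      when t \<ge> 1)"
    unfolding Dup_schar_Sum_any[OF assms(1)] by (intro Sum_any.expand_superset) simp_all
  also have "\<dots> = (\<Sum>t = 1..N. (- 1) ^ (t + 1) * hr g p (lam t - int t + 2) * schar g (remove_part t lam))"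
    by (rule sum.cong) simp_all
  finally show ?thesis .
qed

lemma Dup_nonneg_schar:
  assumes lam: "is_partition lam" and "0 \<le> p"
  shows "Dup g p (schar g lam) = 0"
proof -
  obtain l where l: "zero_beyond l lam"
    using is_partition_zero_beyond[OF lam] by blast
  have "Dup g (int (nat p)) (schar g lam) = 0"
    using sum_remove_part_zero[OF l, of "l + nat p + 2" "nat p" g]
    by (subst Dup_schar[OF lam l, of "l + nat p + 2"]) auto
  with assms(2) show ?thesis
    by simp
qed

text \<open>For \<open>n \<le> 0\<close> the second operator vanishes and \<open>h^(n)\<close> is a
  single \<open>J\<close>. For \<open>n > 0\<close>, the vanishing of \<open>D^(n)\<close> reads
  \<open>S n + S (- n) = 0\<close>, and \<open>S (- n)\<close> is the value of
  \<open>D^(-n)\<close>; hence one formula covers both signs.\<close>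

lemma Dup_diff_schar:
  assumes lam: "is_partition lam" and l: "zero_beyond l lam" "l < N" and n: "\<bar>n\<bar> + 2 \<le> int N"
  shows "Dup g n (schar g lam) - Dup g (- n) (schar g lam) =
    (\<Sum>t = 1..N. (- 1) ^ (t + 1) * J g (n + (lam t - int t + 2)) * schar g (remove_part t lam))"
proof (cases "n \<le> 0")
  case True
  then show ?thesis
    using Dup_schar[OF lam l n, of g] Dup_nonneg_schar[OF lam, of "- n" g]
    by (simp add: hr_def add.commute)
next
  case False
  define S where "S r = (\<Sum>t = 1..N. (- 1) ^ (t + 1) * J g (r + (lam t - int t + 2)) * schar g (remove_part t lam))" for r
  have "0 = Dup g n (schar g lam)"
    using False by (simp add: Dup_nonneg_schar[OF lam])
  also have "\<dots> = S n + S (- n)"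
    using False unfolding Dup_schar[OF lam l n] S_def sum.distrib[symmetric]
    by (intro sum.cong) (auto simp: hr_def algebra_simps)
  finally have "S n = - S (- n)"
    by (simp add: eq_neg_iff_add_eq_0)
  moreover have "Dup g (- n) (schar g lam) = S (- n)"
    using False n by (subst Dup_schar[OF lam l]) (auto simp: S_def hr_def algebra_simps)
  ultimately have "Dup g n (schar g lam) - Dup g (- n) (schar g lam) = S n"
    using False by (simp add: Dup_nonneg_schar[OF lam])
  then show ?thesis
    unfolding S_def .
qed

section \<open>The operators \<open>psi\<close> and \<open>psi_star\<close>\<close>

lemma psi_unique:
  "\<exists>!T. Vector_Spaces.linear scaleF scaleF T \<and>
     (\<forall>lam m. is_partition lam \<longrightarrow>
        T (inB (schar g lam) * zpow m) =
          inB (schar g (prepend (k - m - 1) lam)) * zpow (m + 1))"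
proof (rule linear_fock_ex1)
  fix lam mu :: "nat \<Rightarrow> int" and m
  assume "\<And>i. i \<ge> 1 \<Longrightarrow> lam i = mu i"
  then have "schar g (prepend (k - m - 1) lam) = schar g (prepend (k - m - 1) mu)"
    by (intro schar_cong) (simp add: prepend_def)
  then show "inB (schar g (prepend (k - m - 1) lam)) * zpow (m + 1) =
      inB (schar g (prepend (k - m - 1) mu)) * zpow (m + 1)"
    by simp
qed

lemma linear_psi: "Vector_Spaces.linear scaleF scaleF (psi g k)"
  unfolding psi_def by (rule conjunct1[OF theI'[OF psi_unique]])

lemma psi_schar:
  "is_partition lam \<Longrightarrow> psi g k (Poly_Mapping.single m (schar g lam)) =
    Poly_Mapping.single (m + 1) (schar g (prepend (k - m - 1) lam))"
  unfolding psi_def inB_mult_zpow[symmetric] by (rule conjunct2[OF theI'[OF psi_unique], THEN spec, THEN spec, THEN mp])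

lemma psi_star_unique:
  "\<exists>!T. Vector_Spaces.linear scaleF scaleF T \<and>
     (\<forall>lam m. is_partition lam \<longrightarrow>
        T (inB (schar g lam) * zpow m) =
          inB (Sum_any (\<lambda>t. (- 1) ^ (t + 1) * schar g (remove_part t lam)
                 when t \<ge> 1 \<and> k - m - 1 = lam t - int t)) * zpow (m - 1))"
proof (rule linear_fock_ex1)
  fix lam mu :: "nat \<Rightarrow> int" and m
  assume eq: "\<And>i. i \<ge> 1 \<Longrightarrow> lam i = mu i"
  have "Sum_any (\<lambda>t. (- 1) ^ (t + 1) * schar g (remove_part t lam)
                 when t \<ge> 1 \<and> k - m - 1 = lam t - int t) =
      Sum_any (\<lambda>t. (- 1) ^ (t + 1) * schar g (remove_part t mu)
                 when t \<ge> 1 \<and> k - m - 1 = mu t - int t)"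
    using eq schar_cong[OF remove_part_cong[of lam mu]] by (intro Sum_any.cong when_cong) auto
  then show "inB (Sum_any (\<lambda>t. (- 1) ^ (t + 1) * schar g (remove_part t lam)
                 when t \<ge> 1 \<and> k - m - 1 = lam t - int t)) * zpow (m - 1) =
      inB (Sum_any (\<lambda>t. (- 1) ^ (t + 1) * schar g (remove_part t mu)
                 when t \<ge> 1 \<and> k - m - 1 = mu t - int t)) * zpow (m - 1)"
    by simp
qed

lemma linear_psi_star: "Vector_Spaces.linear scaleF scaleF (psi_star g k)"
  unfolding psi_star_def by (rule conjunct1[OF theI'[OF psi_star_unique]])

lemma psi_star_schar:
  "is_partition lam \<Longrightarrow> psi_star g k (Poly_Mapping.single m (schar g lam)) =
    Poly_Mapping.single (m - 1) (Sum_any (\<lambda>t. (- 1) ^ (t + 1) * schar g (remove_part t lam)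
                 when t \<ge> 1 \<and> k - m - 1 = lam t - int t))"
  unfolding psi_star_def inB_mult_zpow[symmetric] by (rule conjunct2[OF theI'[OF psi_star_unique], THEN spec, THEN spec, THEN mp])

section \<open>The generating functions\<close>

lemma Sum_any_single: "Sum_any (\<lambda>i. Poly_Mapping.single m (h i)) = Poly_Mapping.single m (Sum_any h)"
proof -
  have "(\<Sum>i\<in>A. Poly_Mapping.single m (h i)) = Poly_Mapping.single m (\<Sum>i\<in>A. h i)" for A
    by (induction A rule: infinite_finite_induct) (auto simp: single_add)
  moreover have "Poly_Mapping.single m (h i) = 0 \<longleftrightarrow> h i = 0" for i
    by (metis lookup_single_eq lookup_zero single_zero)
  ultimately show ?thesis
    by (simp add: Sum_any.expand_set)
qed

lemma inB_mult_single: "inB f * Poly_Mapping.single m f' = Poly_Mapping.single m (f * f')"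
  by (simp add: inB_def Poly_Mapping.mult_single)

lemma zpow_mult_single: "zpow n * Poly_Mapping.single m f = Poly_Mapping.single (n + m) f"
  by (simp add: zpow_def Poly_Mapping.mult_single)

lemma charge_eq: "charge m = range (Poly_Mapping.single m)"
  by (simp add: charge_def inB_mult_zpow mult.commute[of "zpow m"])

lemma ser_monom_mult: "(ser_monom k T \<star> X) n F = T (X (n - k) F)"
  by (simp add: ser_mult_def ser_monom_def)

text \<open>The coefficients of \<open>DE(-u) + DE(-1/u) - D\<^sub>0\<close>.\<close>

definition dsym :: "lie_type \<Rightarrow> symf \<Rightarrow> int \<Rightarrow> symf" where
  "dsym g f n = (- 1) ^ nat \<bar>n\<bar> * Dlow g n f + (- 1) ^ nat \<bar>n\<bar> * Dlow g (- n) f - (Dlow g 0 f when n = 0)"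

lemma Dlow_0 [simp]: "Dlow g p 0 = 0"
proof -
  interpret Vector_Spaces.linear scaleB scaleB "Dlow g p" by (rule linear_Dlow)
  show ?thesis by (rule zero)
qed

lemma Dup_0 [simp]: "Dup g p 0 = 0"
proof -
  interpret Vector_Spaces.linear scaleB scaleB "Dup g p" by (rule linear_Dup)
  show ?thesis by (rule zero)
qed

lemma neg_one_power_mult_single:
  "(- 1) ^ k * Poly_Mapping.single (m :: int) f = Poly_Mapping.single m ((- 1) ^ k * f)" for f :: symf
  by (cases "even k") (simp_all flip: single_uminus)

section \<open>The first identity, coefficientwise on \<open>z^m f\<close>\<close>

lemma Psi_rhs:
  "(ser_monom (m + 1) (\<lambda>F. zpow 1 * F) \<star> Jser g \<star>
     (subst_neg (DE g) + subst_inv (subst_neg (DE g)) - ser_monom 0 (extend_z (Dlow g 0)))) k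
     (Poly_Mapping.single m f) =
   Poly_Mapping.single (m + 1) (Sum_any (\<lambda>i. J g i * dsym g f (k - m - 1 - i)))"
proof -
  have "(subst_neg (DE g) + subst_inv (subst_neg (DE g)) - ser_monom 0 (extend_z (Dlow g 0))) n
      (Poly_Mapping.single m f) = Poly_Mapping.single m (dsym g f n)" for n
    by (simp add: plus_fun_def fun_diff_def subst_neg_def subst_inv_def DE_def extend_z_def
        ser_monom_def dsym_def neg_one_power_mult_single single_add single_diff when_def)
  then show ?thesis
    by (simp add: ser_monom_mult)
       (simp add: ser_mult_def Jser_def inB_mult_single Sum_any_single zpow_mult_single algebra_simps)
qed

text \<open>The sign \<open>s\<close> treats \<open>DE(-u)\<close> and \<open>DE(-1/u)\<close>
  together; the substitution \<open>p = s * (a - i)\<close> moves the sum onto a range containing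
  the support of \<open>c\<close>.\<close>

lemma Sum_any_shift_finite:
  fixes c :: "int \<Rightarrow> symf" and s a :: int
  assumes "\<And>n. c n \<noteq> 0 \<Longrightarrow> 0 \<le> n \<and> n \<le> int l" and s: "s = 1 \<or> s = - 1"
  shows "Sum_any (\<lambda>i. F i * c (s * (a - i))) = (\<Sum>p\<le>l. F (a - s * int p) * c (int p))"
proof -
  have ss: "s * s = 1" "s * (s * x) = x" for x
    using s by auto
  have "Sum_any (\<lambda>i. F i * c (s * (a - i))) =
      (\<Sum>i\<in>(\<lambda>p. a - s * int p) ` {..l}. F i * c (s * (a - i)))"
  proof (rule Sum_any.expand_superset)
    show "{i. F i * c (s * (a - i)) \<noteq> 0} \<subseteq> (\<lambda>p. a - s * int p) ` {..l}"
    proof safe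
      fix i assume "F i * c (s * (a - i)) \<noteq> 0"
      then have *: "0 \<le> s * (a - i)" "s * (a - i) \<le> int l"
        using assms(1)[of "s * (a - i)"] by auto
      show "i \<in> (\<lambda>p. a - s * int p) ` {..l}"
        by (rule image_eqI[of _ _ "nat (s * (a - i))"]) (use * in \<open>auto simp: ss\<close>)
    qed
  qed simp
  also have "\<dots> = (\<Sum>p\<le>l. F (a - s * int p) * c (int p))"
    using s by (subst sum.reindex) (auto simp: inj_on_def ss)
  finally show ?thesis .
qed

lemma dlow_outside: "dlow g n lam l \<noteq> 0 \<Longrightarrow> 0 \<le> n \<and> n \<le> int l"
  by (auto simp: dlow_def split: if_splits)

text \<open>Both sides are linear in \<open>f\<close>, so characters suffice. The induction also
  carries the finite support of \<open>dsym g f\<close>, since additivity of \<open>Sum_any\<close>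
  rests on finite supports.\<close>

lemma psi_single:
  "psi g k (Poly_Mapping.single m f) =
    Poly_Mapping.single (m + 1) (Sum_any (\<lambda>i. J g i * dsym g f (k - m - 1 - i)))"
proof -
  define a where "a = k - m - 1"
  interpret psi: Vector_Spaces.linear scaleF scaleF "psi g k" by (rule linear_psi)
  note D = linear_Dlow[of g, unfolded Vector_Spaces.linear_iff]
  have dsym_add: "dsym g (f + f') n = dsym g f n + dsym g f' n" for f f' n
    using D by (simp add: dsym_def when_def algebra_simps)
  have dsym_scale: "dsym g (scaleB c f) n = scaleB c (dsym g f n)" for c f n
    using D by (simp add: dsym_def when_def scaleB_def algebra_simps)
  have fin: "finite {i. J g i * dsym g f (a - i) \<noteq> 0}" if "finite {n. dsym g f n \<noteq> 0}" for f
  proof (rule finite_subset)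
    show "{i. J g i * dsym g f (a - i) \<noteq> 0} \<subseteq> (\<lambda>i. a - i) -` {n. dsym g f n \<noteq> 0}"
      by auto
    show "finite ((\<lambda>i. a - i) -` {n. dsym g f n \<noteq> 0})"
      using that by (intro finite_vimageI) (auto intro: injI)
  qed
  have "finite {n. dsym g f n \<noteq> 0} \<and> psi g k (Poly_Mapping.single m f) =
    Poly_Mapping.single (m + 1) (Sum_any (\<lambda>i. J g i * dsym g f (a - i)))"
  proof (induction f rule: symf_induct[of _ g])
    case (schar lam)
    obtain l where l: "zero_beyond l lam"
      using is_partition_zero_beyond[OF schar] by blast
    define c where "c n = (- 1) ^ nat \<bar>n\<bar> * dlow g n lam l" for n
    have c: "0 \<le> n \<and> n \<le> int l" if "c n \<noteq> 0" for n
      using that dlow_outside[of g n lam l] by (auto simp: c_def)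
    have dsym: "dsym g (schar g lam) n = c n + c (- n) - (c 0 when n = 0)" for n
      by (simp add: dsym_def c_def Dlow_schar[OF schar l])
    have fin_c: "finite {n. dsym g (schar g lam) n \<noteq> 0}"
    proof (rule finite_subset)
      show "{n. dsym g (schar g lam) n \<noteq> 0} \<subseteq> {- int l..int l}"
      proof
        fix n assume "n \<in> {n. dsym g (schar g lam) n \<noteq> 0}"
        then have "c n \<noteq> 0 \<or> c (- n) \<noteq> 0"
          by (cases "n = 0") (auto simp: dsym)
        then show "n \<in> {- int l..int l}"
          using c[of n] c[of "- n"] by auto
      qed
    qed simp
    have fin': "finite {i. J g i * c (s * (a - i)) \<noteq> 0}" if "s = 1 \<or> s = - 1" for s
    proof (rule finite_subset)
      show "{i. J g i * c (s * (a - i)) \<noteq> 0} \<subseteq> {a - int l..a + int l}"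
      proof
        fix i assume "i \<in> {i. J g i * c (s * (a - i)) \<noteq> 0}"
        then show "i \<in> {a - int l..a + int l}"
          using c[of "s * (a - i)"] that by auto
      qed
    qed simp
    \<comment> \<open>The two sums count \<open>p = 0\<close> twice; the term at
      \<open>i = a\<close> takes one copy away.\<close>
    have "Sum_any (\<lambda>i. J g i * dsym g (schar g lam) (a - i)) =
        Sum_any (\<lambda>i. J g i * c (1 * (a - i)) + J g i * c (- 1 * (a - i)) + (- (J g i * c 0) when i = a))"
      by (rule Sum_any.cong) (auto simp: dsym when_def algebra_simps)
    also have "\<dots> = Sum_any (\<lambda>i. J g i * c (1 * (a - i))) + Sum_any (\<lambda>i. J g i * c (- 1 * (a - i))) +
        Sum_any (\<lambda>i. - (J g i * c 0) when i = a)"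
    proof (subst Sum_any.distrib)
      show "finite {i. J g i * c (1 * (a - i)) + J g i * c (- 1 * (a - i)) \<noteq> 0}"
        by (rule finite_subset[OF _ finite_UnI[OF fin'[of 1] fin'[of "- 1"]]]) auto
      show "finite {i. (- (J g i * c 0) when i = a) \<noteq> 0}"
        by (rule finite_subset[of _ "{a}"]) (auto simp: when_def split: if_splits)
      show "Sum_any (\<lambda>i. J g i * c (1 * (a - i)) + J g i * c (- 1 * (a - i))) +
          Sum_any (\<lambda>i. - (J g i * c 0) when i = a) =
        Sum_any (\<lambda>i. J g i * c (1 * (a - i))) + Sum_any (\<lambda>i. J g i * c (- 1 * (a - i))) +
        Sum_any (\<lambda>i. - (J g i * c 0) when i = a)"
        using fin'[of 1] fin'[of "- 1"] by (subst Sum_any.distrib) auto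
    qed
    also have "\<dots> = (\<Sum>p\<le>l. J g (a - 1 * int p) * c (int p)) + (\<Sum>p\<le>l. J g (a - (- 1) * int p) * c (int p)) - J g a * c 0"
      by (subst (1 2) Sum_any_shift_finite[OF c]) simp_all
    also have "\<dots> = (\<Sum>p\<le>l. (- 1) ^ p * hr g (int p) a * dlow g (int p) lam l)"
    proof -
      \<comment> \<open>The indices \<open>a - p\<close> and \<open>a + p\<close> together give
        \<open>hr g (int p) a\<close>; at \<open>p = 0\<close> the correction leaves the single term
        \<open>J g a\<close>.\<close>
      have "(\<Sum>p\<le>l. (- 1) ^ p * hr g (int p) a * dlow g (int p) lam l) =
          (\<Sum>p\<le>l. J g (a - int p) * c (int p) + J g (a + int p) * c (int p) - (if p = 0 then J g a * c 0 else 0))"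
        by (rule sum.cong) (auto simp: hr_def c_def algebra_simps)
      then show ?thesis
        by (simp add: sum.distrib sum_subtractf)
    qed
    finally show ?case
      using fin_c psi_schar[OF schar] schar_prepend[OF l] by (simp add: a_def)
  next
    case (add f f')
    have "finite {n. dsym g (f + f') n \<noteq> 0}"
    proof (rule finite_subset)
      show "{n. dsym g (f + f') n \<noteq> 0} \<subseteq> {n. dsym g f n \<noteq> 0} \<union> {n. dsym g f' n \<noteq> 0}"
        by (auto simp: dsym_add)
    qed (use add in simp)
    moreover have "Sum_any (\<lambda>i. J g i * dsym g (f + f') (a - i)) =
        Sum_any (\<lambda>i. J g i * dsym g f (a - i)) + Sum_any (\<lambda>i. J g i * dsym g f' (a - i))"
      unfolding dsym_add distrib_left by (rule Sum_any.distrib) (use add fin in blast)+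
    ultimately show ?case
      using add by (simp only: single_add psi.add)
  next
    case (scale c f)
    have "finite {n. dsym g (scaleB c f) n \<noteq> 0}"
    proof (rule finite_subset)
      show "{n. dsym g (scaleB c f) n \<noteq> 0} \<subseteq> {n. dsym g f n \<noteq> 0}"
        by (auto simp: dsym_scale)
    qed (use scale in simp)
    moreover have "Sum_any (\<lambda>i. J g i * dsym g (scaleB c f) (a - i)) =
        scaleB c (Sum_any (\<lambda>i. J g i * dsym g f (a - i)))"
    proof -
      have "finite {i. J g i * dsym g f (a - i) \<noteq> 0}"
        using scale fin by blast
      moreover have "J g i * dsym g (scaleB c f) (a - i) = Poly_Mapping.single 0 c * (J g i * dsym g f (a - i))" for i
        by (simp only: dsym_scale) (simp only: scaleB_def mult.left_commute)
      ultimately show ?thesis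
        by (simp only: scaleB_def[of c "Sum_any _"] Sum_any_right_distrib)
    qed
    ultimately show ?case
      using scale by (simp only: scaleB_single psi.scale)
  qed
  then show ?thesis
    by (simp add: a_def)
qed

section \<open>The second identity\<close>

definition Jinv :: "lie_type \<Rightarrow> nat \<Rightarrow> symf" where
  "Jinv g = fps_nth (fps_right_inverse (Abs_fps (\<lambda>s. J g (int s))) 1)"

text \<open>The coefficient of \<open>u^d\<close> in \<open>J(u)^-1 J(u) = 1\<close>. The bound
  \<open>d \<le> M\<close> loses no term, as \<open>J g (d - i)\<close> vanishes for
  \<open>i > d\<close>.\<close>

lemma Jinv_convolution:
  assumes "d \<le> int M"
  shows "(\<Sum>i\<le>M. Jinv g i * J g (d - int i)) = (1 when d = 0)"
proof (cases "d < 0")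
  case False
  define A where "A = Abs_fps (\<lambda>s. J g (int s))"
  have "(\<Sum>i\<le>M. Jinv g i * J g (d - int i)) = (\<Sum>i\<le>nat d. Jinv g i * J g (d - int i))"
    using assms False by (intro sum.mono_neutral_right) auto
  also have "\<dots> = (\<Sum>i\<le>nat d. Jinv g i * J g (int (nat d - i)))"
    using False by (intro sum.cong) (auto simp: of_nat_diff)
  also have "\<dots> = fps_nth (fps_right_inverse A 1 * A) (nat d)"
    by (simp add: fps_mult_nth atLeast0AtMost Jinv_def A_def)
  also have "fps_right_inverse A 1 * A = 1"
    using fps_right_inverse[of A 1] by (simp add: A_def mult.commute)
  finally show ?thesis
    using False by (simp add: when_def)
qed simp

text \<open>The coefficients of \<open>DH(u) - DH(1/u)\<close>.\<close>

definition uanti :: "lie_type \<Rightarrow> symf \<Rightarrow> int \<Rightarrow> symf" where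
  "uanti g f n = Dup g n f - Dup g (- n) f"

lemma Psi_star_rhs:
  "(ser_monom (- m + 1) (\<lambda>F. zpow (- 1) * F) \<star> Jser_inv g \<star> (DH g - subst_inv (DH g))) n
     (Poly_Mapping.single m f) =
   Poly_Mapping.single (m - 1) (Sum_any (\<lambda>i. Jinv g (nat i) * uanti g f (n + m - 1 - i) when i \<ge> 0))"
proof -
  have anti: "(DH g - subst_inv (DH g)) k (Poly_Mapping.single m f) = Poly_Mapping.single m (uanti g f k)" for k
    by (simp add: fun_diff_def subst_inv_def DH_def extend_z_def uanti_def single_diff)
  have "(inB (Jinv g (nat i)) * Poly_Mapping.single m f' when i \<ge> 0) =
      Poly_Mapping.single m (Jinv g (nat i) * f' when i \<ge> 0)" for i f'
    by (simp add: when_def inB_mult_single)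
  then have "(Jser_inv g \<star> (DH g - subst_inv (DH g))) k (Poly_Mapping.single m f) =
      Poly_Mapping.single m (Sum_any (\<lambda>i. Jinv g (nat i) * uanti g f (k - i) when i \<ge> 0))" for k
    unfolding ser_mult_def Jser_inv_def Jinv_def[symmetric] anti by (simp only: Sum_any_single)
  moreover have "n - (- m + 1) = n + m - 1" "- 1 + m = m - 1"
    by simp_all
  ultimately show ?thesis
    by (simp only: ser_monom_mult zpow_mult_single)
qed

text \<open>The largest \<open>J\<close> index, \<open>n + lam 1 + 1\<close> at
  \<open>t = 1\<close>, is negative. This lower bound on the exponents of \<open>u\<close> makes the
  product with the power series \<open>J(u)^-1\<close> finite.\<close>

lemma uanti_schar_zero:
  assumes "is_partition lam" "n < - lam 1 - 1"
  shows "uanti g (schar g lam) n = 0"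
proof -
  obtain l where l: "zero_beyond l lam"
    using is_partition_zero_beyond[OF assms(1)] by blast
  have "J g (n + (lam t - int t + 2)) = 0" if "t \<ge> 1" for t
    using partition_antimono[OF assms(1), of 1 t] assms(2) that by simp
  then show ?thesis
    unfolding uanti_def
    by (subst Dup_diff_schar[OF assms(1) l, of "l + nat \<bar>n\<bar> + 2"]) (auto intro!: sum.neutral)
qed

text \<open>\<open>DH(u) - DH(1/u)\<close> has the factor \<open>J(u)\<close> in every summand, which \<open>J(u)\<^sup>-\<^sup>1\<close> cancels.\<close>

lemma Sum_any_Jinv_uanti_schar:
  assumes lam: "is_partition lam"
  shows "Sum_any (\<lambda>i. Jinv g (nat i) * uanti g (schar g lam) (c - i) when i \<ge> 0) =
    Sum_any (\<lambda>t. (- 1) ^ (t + 1) * schar g (remove_part t lam) when t \<ge> 1 \<and> - c - 2 = lam t - int t)"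
proof -
  obtain l where l: "zero_beyond l lam"
    using is_partition_zero_beyond[OF lam] by blast
  \<comment> \<open>\<open>M\<close> exceeds \<open>c + lam 1 + 1\<close>, which bounds both the
    \<open>i\<close> with a nonzero term and the degrees \<open>c + lam t - t + 2\<close> of the
    convolutions.\<close>
  define M where "M = nat (\<bar>c\<bar> + \<bar>lam 1\<bar> + 2)"
  \<comment> \<open>\<open>N\<close> admits \<open>Dup_diff_schar\<close> at \<open>c - i\<close>
    for all \<open>i \<le> M\<close> simultaneously.\<close>
  define N where "N = l + nat \<bar>c\<bar> + M + 3"
  have "Sum_any (\<lambda>i. Jinv g (nat i) * uanti g (schar g lam) (c - i) when i \<ge> 0) =
      (\<Sum>i\<in>int ` {..M}. Jinv g (nat i) * uanti g (schar g lam) (c - i) when i \<ge> 0)"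
  proof (rule Sum_any.expand_superset)
    show "{i. (Jinv g (nat i) * uanti g (schar g lam) (c - i) when i \<ge> 0) \<noteq> 0} \<subseteq> int ` {..M}"
    proof
      fix i assume "i \<in> {i. (Jinv g (nat i) * uanti g (schar g lam) (c - i) when i \<ge> 0) \<noteq> 0}"
      then have "0 \<le> i" "uanti g (schar g lam) (c - i) \<noteq> 0"
        by auto
      then have "0 \<le> i" "\<not> c - i < - lam 1 - 1"
        using uanti_schar_zero[OF lam] by blast+
      then have "0 \<le> i" "i \<le> int M"
        by (auto simp: M_def)
      then show "i \<in> int ` {..M}"
        by (intro image_eqI[of _ _ "nat i"]) auto
    qed
  qed simp
  also have "\<dots> = (\<Sum>i\<le>M. Jinv g i * uanti g (schar g lam) (c - int i))"
    by (subst sum.reindex) auto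
  also have "\<dots> = (\<Sum>i\<le>M. \<Sum>t = 1..N. (- 1) ^ (t + 1) * schar g (remove_part t lam) *
      (Jinv g i * J g (c + (lam t - int t + 2) - int i)))"
  proof (rule sum.cong[OF refl])
    fix i assume "i \<in> {..M}"
    then have "\<bar>c - int i\<bar> + 2 \<le> int N"
      by (auto simp: N_def)
    moreover have "l < N"
      by (simp add: N_def)
    ultimately show "Jinv g i * uanti g (schar g lam) (c - int i) =
        (\<Sum>t = 1..N. (- 1) ^ (t + 1) * schar g (remove_part t lam) *
          (Jinv g i * J g (c + (lam t - int t + 2) - int i)))"
      unfolding uanti_def
      by (subst Dup_diff_schar[OF lam l]) (auto simp: sum_distrib_left algebra_simps intro!: sum.cong)
  qed
  also have "\<dots> = (\<Sum>t = 1..N. (- 1) ^ (t + 1) * schar g (remove_part t lam) *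
      (\<Sum>i\<le>M. Jinv g i * J g (c + (lam t - int t + 2) - int i)))"
    by (subst sum.swap) (simp add: sum_distrib_left)
  also have "\<dots> = (\<Sum>t = 1..N. (- 1) ^ (t + 1) * schar g (remove_part t lam)
      when t \<ge> 1 \<and> - c - 2 = lam t - int t)"
  proof (rule sum.cong[OF refl])
    fix t assume t: "t \<in> {1..N}"
    then have "c + (lam t - int t + 2) \<le> int M"
      using partition_antimono[OF lam, of 1 t] by (auto simp: M_def)
    then have "(\<Sum>i\<le>M. Jinv g i * J g (c + (lam t - int t + 2) - int i)) =
        (1 when c + (lam t - int t + 2) = 0)"
      by (rule Jinv_convolution)
    then show "(- 1) ^ (t + 1) * schar g (remove_part t lam) *
        (\<Sum>i\<le>M. Jinv g i * J g (c + (lam t - int t + 2) - int i)) =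
      ((- 1) ^ (t + 1) * schar g (remove_part t lam) when t \<ge> 1 \<and> - c - 2 = lam t - int t)"
      using t by (auto simp: when_def)
  qed
  also have "\<dots> = Sum_any (\<lambda>t. (- 1) ^ (t + 1) * schar g (remove_part t lam) when t \<ge> 1 \<and> - c - 2 = lam t - int t)"
  proof (rule Sum_any.expand_superset[symmetric])
    show "{t. ((- 1) ^ (t + 1) * schar g (remove_part t lam) when t \<ge> 1 \<and> - c - 2 = lam t - int t) \<noteq> 0}
        \<subseteq> {1..N}"
    proof
      fix t assume "t \<in> {t. ((- 1) ^ (t + 1) * schar g (remove_part t lam) when t \<ge> 1 \<and> - c - 2 = lam t - int t) \<noteq> 0}"
      then have t: "t \<ge> 1" "- c - 2 = lam t - int t"
        by auto
      show "t \<in> {1..N}"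
      proof (cases "t \<le> l")
        \<comment> \<open>Past \<open>l\<close> the equation forces \<open>t = c + 2\<close>, which
          is at most \<open>N\<close>.\<close>
        case False
        then have "lam t = 0"
          using l by (simp add: zero_beyond_def)
        with t show ?thesis
          by (auto simp: N_def)
      qed (use t in \<open>auto simp: N_def\<close>)
    qed
  qed simp
  finally show ?thesis .
qed

text \<open>Linearity in \<open>f\<close> again. The induction now carries a bound \<open>K\<close>
  below which \<open>uanti g f\<close> vanishes; together with \<open>i \<ge> 0\<close> it leaves
  finitely many terms.\<close>

lemma psi_star_single:
  "psi_star g (- n) (Poly_Mapping.single m f) =
    Poly_Mapping.single (m - 1) (Sum_any (\<lambda>i. Jinv g (nat i) * uanti g f (n + m - 1 - i) when i \<ge> 0))"
proof -
  define c where "c = n + m - 1"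
  interpret psi_star: Vector_Spaces.linear scaleF scaleF "psi_star g (- n)" by (rule linear_psi_star)
  note D = linear_Dup[of g, unfolded Vector_Spaces.linear_iff]
  have uanti_add: "uanti g (f + f') k = uanti g f k + uanti g f' k" for f f' k
    using D by (simp add: uanti_def)
  have uanti_scale: "uanti g (scaleB a f) k = scaleB a (uanti g f k)" for a f k
    using D by (simp add: uanti_def B.scale_right_diff_distrib)
  have fin: "finite {i. (Jinv g (nat i) * uanti g f (c - i) when i \<ge> 0) \<noteq> 0}"
    if "\<And>k. k < K \<Longrightarrow> uanti g f k = 0" for f K
  proof (rule finite_subset)
    show "{i. (Jinv g (nat i) * uanti g f (c - i) when i \<ge> 0) \<noteq> 0} \<subseteq> {0..c - K}"
    proof
      fix i assume "i \<in> {i. (Jinv g (nat i) * uanti g f (c - i) when i \<ge> 0) \<noteq> 0}"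
      then show "i \<in> {0..c - K}"
        using that[of "c - i"] by (cases "c - i < K") auto
    qed
  qed simp
  have "(\<exists>K. \<forall>k<K. uanti g f k = 0) \<and> psi_star g (- n) (Poly_Mapping.single m f) =
    Poly_Mapping.single (m - 1) (Sum_any (\<lambda>i. Jinv g (nat i) * uanti g f (c - i) when i \<ge> 0))"
  proof (induction f rule: symf_induct[of _ g])
    case (schar lam)
    \<comment> \<open>The index is \<open>- n\<close> as \<open>Psi_star\<close> is a series in
      \<open>1/u\<close>; so the condition on \<open>t\<close> becomes
      \<open>- c - 2 = lam t - t\<close>.\<close>
    have "- n - m - 1 = - c - 2"
      by (simp add: c_def)
    then have "psi_star g (- n) (Poly_Mapping.single m (schar g lam)) = Poly_Mapping.single (m - 1)
        (Sum_any (\<lambda>i. Jinv g (nat i) * uanti g (schar g lam) (c - i) when i \<ge> 0))"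
      by (simp only: psi_star_schar[OF schar] Sum_any_Jinv_uanti_schar[OF schar])
    then show ?case
      using uanti_schar_zero[OF schar, of _ g] by blast
  next
    case (add f f')
    obtain K K' where K: "\<And>k. k < K \<Longrightarrow> uanti g f k = 0" "\<And>k. k < K' \<Longrightarrow> uanti g f' k = 0"
      using add by blast
    have "\<forall>k<min K K'. uanti g (f + f') k = 0"
      by (simp add: K uanti_add)
    moreover have "Sum_any (\<lambda>i. Jinv g (nat i) * uanti g (f + f') (c - i) when i \<ge> 0) =
        Sum_any (\<lambda>i. Jinv g (nat i) * uanti g f (c - i) when i \<ge> 0) +
        Sum_any (\<lambda>i. Jinv g (nat i) * uanti g f' (c - i) when i \<ge> 0)"
      unfolding uanti_add distrib_left when_add_distrib by (rule Sum_any.distrib[OF fin[OF K(1)] fin[OF K(2)]])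
    ultimately show ?case
      using add by (intro conjI exI[of _ "min K K'"]) (simp_all only: single_add psi_star.add)
  next
    case (scale a f)
    obtain K where K: "\<And>k. k < K \<Longrightarrow> uanti g f k = 0"
      using scale by blast
    then have "\<forall>k<K. uanti g (scaleB a f) k = 0"
      by (simp add: uanti_scale)
    moreover have "Sum_any (\<lambda>i. Jinv g (nat i) * uanti g (scaleB a f) (c - i) when i \<ge> 0) =
        scaleB a (Sum_any (\<lambda>i. Jinv g (nat i) * uanti g f (c - i) when i \<ge> 0))"
    proof -
      have "(Jinv g (nat i) * uanti g (scaleB a f) (c - i) when i \<ge> 0) =
          Poly_Mapping.single 0 a * (Jinv g (nat i) * uanti g f (c - i) when i \<ge> 0)" for i
        by (simp only: uanti_scale) (simp only: scaleB_def mult_when mult.left_commute)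
      then show ?thesis
        by (simp only: scaleB_def[of a "Sum_any _"] Sum_any_right_distrib[OF fin[OF K]])
    qed
    ultimately show ?case
      using scale by (intro conjI exI[of _ K]) (simp_all only: scaleB_single psi_star.scale)
  qed
  then show ?thesis
    by (simp add: c_def)
qed

theorem proposition5p2:
  fixes g :: lie_type and m :: int
  shows "Psi g m = ser_restrict m
           (ser_monom (m + 1) (\<lambda>F. zpow 1 * F) \<star> Jser g \<star>
             (subst_neg (DE g) + subst_inv (subst_neg (DE g)) - ser_monom 0 (extend_z (Dlow g 0))))
       \<and> Psi_star g m = ser_restrict m
           (ser_monom (- m + 1) (\<lambda>F. zpow (- 1) * F) \<star> Jser_inv g \<star>
             (DH g - subst_inv (DH g)))"
proof
  show "Psi g m = ser_restrict m
           (ser_monom (m + 1) (\<lambda>F. zpow 1 * F) \<star> Jser g \<star>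
             (subst_neg (DE g) + subst_inv (subst_neg (DE g)) - ser_monom 0 (extend_z (Dlow g 0))))"
    unfolding Psi_def ser_restrict_def
  proof (rule ext, rule restrict_ext)
    fix k F assume "F \<in> charge m"
    then obtain f where "F = Poly_Mapping.single m f"
      by (auto simp: charge_eq)
    then show "psi g k F = (ser_monom (m + 1) (\<lambda>F. zpow 1 * F) \<star> Jser g \<star>
        (subst_neg (DE g) + subst_inv (subst_neg (DE g)) - ser_monom 0 (extend_z (Dlow g 0)))) k F"
      by (simp only: psi_single Psi_rhs)
  qed
  show "Psi_star g m = ser_restrict m
           (ser_monom (- m + 1) (\<lambda>F. zpow (- 1) * F) \<star> Jser_inv g \<star>
             (DH g - subst_inv (DH g)))"
    unfolding Psi_star_def ser_restrict_def
  proof (rule ext, rule restrict_ext)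
    fix n F assume "F \<in> charge m"
    then obtain f where "F = Poly_Mapping.single m f"
      by (auto simp: charge_eq)
    then show "psi_star g (- n) F = (ser_monom (- m + 1) (\<lambda>F. zpow (- 1) * F) \<star> Jser_inv g \<star>
        (DH g - subst_inv (DH g))) n F"
      by (simp only: psi_star_single Psi_star_rhs)
  qed
qed

end
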